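(* Assume that $\mathsf{MM}(n)/n^2$ is nondecreasing in $n$. Then the Node-Weighted Triangle problem on $n$-vertex graphs can be solved in $O(\mathsf{MM}(n))$ time.
   Context: For integers $a,b,c\ge 1$, $\mathsf{MM}(a,b,c)$ denotes the time complexity of multiplying an $a\times b$ matrix by a $b\times c$ matrix, and $\mathsf{MM}(n)=\mathsf{MM}(n,n,n)$. Node-Weighted Triangle: given an undirected graph $G=(V,E)$ with $n$ vertices and an integer weight $\mathrm{wt}(v)$ on each vertex $v$, decide whether $G$ contains a triangle (three mutually adjacent vertices $x,y,z$) with $\mathrm{wt}(x)+\mathrm{wt}(y)+\mathrm{wt}(z)=0$. Weights can be added and compared in constant time. *)

theory Defs
  imports
    "HOL-Library.Landau_Symbols"
    "Jordan_Normal_Form.Matrix"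
begin

text \<open>
  The model of computation is a word RAM, presented by structured programs with unit-cost
  operations. There are two sorts of values.

  \<^item> Words: signed integers of bounded length. An operation whose result (or a literal which)
    does not fit into a word has no execution, so a program that halts never overflows.
  \<^item> Weights: arbitrary integers on which the only operations are zero, addition, copying and
    comparison; each takes one step.

  Each sort has registers and finitely many arrays per program, both named by natural numbers;
  arrays are indexed by words. Memory that does not belong to the input is uninitialised: a program
  has to be correct whatever words it finds there.
\<close>

section \<open>Syntax\<close>

datatype binop = Add | Sub | Mul | Div | Mod | BitAnd | BitOr | BitXor | Shl | Shr

datatype wexp = Lit int | Var nat | Arr nat wexp | Bin binop wexp wexp

datatype wtexp = WtZero | WtVar nat | WtArr nat wexp | WtAdd wtexp wtexp

datatype test = Eq wexp wexp | Less wexp wexp | WtEq wtexp wtexp | WtLess wtexp wtexp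
  | Neg test | Conj test test

datatype prog = Skip
  | Assign nat wexp
  | Store nat wexp wexp     \<comment> \<open>array, index, value\<close>
  | WtAssign nat wtexp
  | WtStore nat wexp wtexp  \<comment> \<open>array, index, value\<close>
  | Seq prog prog
  | Cond test prog prog
  | While test prog


section \<open>Semantics and running time\<close>

record state =
  var :: "nat \<Rightarrow> int"
  arr :: "nat \<Rightarrow> int \<Rightarrow> int"
  wvar :: "nat \<Rightarrow> int"
  warr :: "nat \<Rightarrow> int \<Rightarrow> int"

text \<open>Words have \<open>w\<close> bits and a sign.\<close>

definition is_word :: "nat \<Rightarrow> int \<Rightarrow> bool" where
  "is_word w x \<longleftrightarrow> - (2 ^ w) \<le> x \<and> x < 2 ^ w"

definition word_state :: "nat \<Rightarrow> state \<Rightarrow> bool" where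
  "word_state w s \<longleftrightarrow> (\<forall>x. is_word w (var s x)) \<and> (\<forall>a i. is_word w (arr s a i))"

context
  includes bit_operations_syntax
begin

fun binop_val :: "binop \<Rightarrow> int \<Rightarrow> int \<Rightarrow> int" where
  "binop_val Add x y = x + y"
| "binop_val Sub x y = x - y"
| "binop_val Mul x y = x * y"
| "binop_val Div x y = x div y"
| "binop_val Mod x y = x mod y"
| "binop_val BitAnd x y = x AND y"
| "binop_val BitOr x y = x OR y"
| "binop_val BitXor x y = x XOR y"
| "binop_val Shl x y = push_bit (nat y) x"
| "binop_val Shr x y = drop_bit (nat y) x"

end

fun wval :: "wexp \<Rightarrow> state \<Rightarrow> int" where
  "wval (Lit c) s = c"
| "wval (Var x) s = var s x"
| "wval (Arr a e) s = arr s a (wval e s)"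
| "wval (Bin f e1 e2) s = binop_val f (wval e1 s) (wval e2 s)"

fun wtval :: "wtexp \<Rightarrow> state \<Rightarrow> int" where
  "wtval WtZero s = 0"
| "wtval (WtVar x) s = wvar s x"
| "wtval (WtArr a e) s = warr s a (wval e s)"
| "wtval (WtAdd e1 e2) s = wtval e1 s + wtval e2 s"

fun tval :: "test \<Rightarrow> state \<Rightarrow> bool" where
  "tval (Eq e1 e2) s \<longleftrightarrow> wval e1 s = wval e2 s"
| "tval (Less e1 e2) s \<longleftrightarrow> wval e1 s < wval e2 s"
| "tval (WtEq e1 e2) s \<longleftrightarrow> wtval e1 s = wtval e2 s"
| "tval (WtLess e1 e2) s \<longleftrightarrow> wtval e1 s < wtval e2 s"
| "tval (Neg b) s \<longleftrightarrow> \<not> tval b s"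
| "tval (Conj b1 b2) s \<longleftrightarrow> tval b1 s \<and> tval b2 s"

text \<open>No overflow occurs in any subexpression.\<close>

fun wok :: "nat \<Rightarrow> wexp \<Rightarrow> state \<Rightarrow> bool" where
  "wok w (Lit c) s \<longleftrightarrow> is_word w c"
| "wok w (Var x) s \<longleftrightarrow> is_word w (var s x)"
| "wok w (Arr a e) s \<longleftrightarrow> wok w e s \<and> is_word w (arr s a (wval e s))"
| "wok w (Bin f e1 e2) s \<longleftrightarrow> wok w e1 s \<and> wok w e2 s \<and> is_word w (wval (Bin f e1 e2) s)"

fun wtok :: "nat \<Rightarrow> wtexp \<Rightarrow> state \<Rightarrow> bool" where
  "wtok w WtZero s \<longleftrightarrow> True"
| "wtok w (WtVar x) s \<longleftrightarrow> True"
| "wtok w (WtArr a e) s \<longleftrightarrow> wok w e s"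
| "wtok w (WtAdd e1 e2) s \<longleftrightarrow> wtok w e1 s \<and> wtok w e2 s"

fun tok :: "nat \<Rightarrow> test \<Rightarrow> state \<Rightarrow> bool" where
  "tok w (Eq e1 e2) s \<longleftrightarrow> wok w e1 s \<and> wok w e2 s"
| "tok w (Less e1 e2) s \<longleftrightarrow> wok w e1 s \<and> wok w e2 s"
| "tok w (WtEq e1 e2) s \<longleftrightarrow> wtok w e1 s \<and> wtok w e2 s"
| "tok w (WtLess e1 e2) s \<longleftrightarrow> wtok w e1 s \<and> wtok w e2 s"
| "tok w (Neg b) s \<longleftrightarrow> tok w b s"
| "tok w (Conj b1 b2) s \<longleftrightarrow> tok w b1 s \<and> tok w b2 s"

fun wcost :: "wexp \<Rightarrow> nat" where
  "wcost (Lit c) = 1"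
| "wcost (Var x) = 1"
| "wcost (Arr a e) = wcost e + 1"
| "wcost (Bin f e1 e2) = wcost e1 + wcost e2 + 1"

fun wtcost :: "wtexp \<Rightarrow> nat" where
  "wtcost WtZero = 1"
| "wtcost (WtVar x) = 1"
| "wtcost (WtArr a e) = wcost e + 1"
| "wtcost (WtAdd e1 e2) = wtcost e1 + wtcost e2 + 1"

fun tcost :: "test \<Rightarrow> nat" where
  "tcost (Eq e1 e2) = wcost e1 + wcost e2 + 1"
| "tcost (Less e1 e2) = wcost e1 + wcost e2 + 1"
| "tcost (WtEq e1 e2) = wtcost e1 + wtcost e2 + 1"
| "tcost (WtLess e1 e2) = wtcost e1 + wtcost e2 + 1"
| "tcost (Neg b) = tcost b + 1"
| "tcost (Conj b1 b2) = tcost b1 + tcost b2 + 1"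

text \<open>\<open>exec w P s t s'\<close>: on word length \<open>w\<close>, the program \<open>P\<close> started in \<open>s\<close> halts in \<open>s'\<close> after
  exactly \<open>t\<close> steps, without overflow.\<close>

inductive exec :: "nat \<Rightarrow> prog \<Rightarrow> state \<Rightarrow> nat \<Rightarrow> state \<Rightarrow> bool" for w :: nat where
  Skip: "exec w Skip s 1 s"
| Assign: "wok w e s \<Longrightarrow>
    exec w (Assign x e) s (wcost e + 1) (s\<lparr>var := (var s)(x := wval e s)\<rparr>)"
| Store: "wok w i s \<Longrightarrow> wok w e s \<Longrightarrow>
    exec w (Store a i e) s (wcost i + wcost e + 1)
      (s\<lparr>arr := (arr s)(a := (arr s a)(wval i s := wval e s))\<rparr>)"
| WtAssign: "wtok w e s \<Longrightarrow>
    exec w (WtAssign x e) s (wtcost e + 1) (s\<lparr>wvar := (wvar s)(x := wtval e s)\<rparr>)"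
| WtStore: "wok w i s \<Longrightarrow> wtok w e s \<Longrightarrow>
    exec w (WtStore a i e) s (wcost i + wtcost e + 1)
      (s\<lparr>warr := (warr s)(a := (warr s a)(wval i s := wtval e s))\<rparr>)"
| Seq: "exec w P s t1 s1 \<Longrightarrow> exec w Q s1 t2 s2 \<Longrightarrow> exec w (Seq P Q) s (t1 + t2) s2"
| CondTrue: "tok w b s \<Longrightarrow> tval b s \<Longrightarrow> exec w P s t s' \<Longrightarrow>
    exec w (Cond b P Q) s (tcost b + t) s'"
| CondFalse: "tok w b s \<Longrightarrow> \<not> tval b s \<Longrightarrow> exec w Q s t s' \<Longrightarrow>
    exec w (Cond b P Q) s (tcost b + t) s'"
| WhileFalse: "tok w b s \<Longrightarrow> \<not> tval b s \<Longrightarrow> exec w (While b P) s (tcost b) s"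
| WhileTrue: "tok w b s \<Longrightarrow> tval b s \<Longrightarrow> exec w P s t1 s1 \<Longrightarrow> exec w (While b P) s1 t2 s2 \<Longrightarrow>
    exec w (While b P) s (tcost b + t1 + t2) s2"

inductive_cases exec_elims:
  "exec w Skip s t s'"
  "exec w (Assign x e) s t s'"
  "exec w (Store a i e) s t s'"
  "exec w (WtAssign x v) s t s'"
  "exec w (WtStore a i v) s t s'"
  "exec w (Seq P Q) s t s'"
  "exec w (Cond b P Q) s t s'"

inductive_cases exec_While: "exec w (While b P) s t s'"

lemma exec_deterministic:
  "exec w P s t s' \<Longrightarrow> exec w P s u s'' \<Longrightarrow> t = u \<and> s' = s''"
proof (induction arbitrary: u s'' rule: exec.induct)
  case (Seq P s t1 s1 Q t2 s2)
  obtain u1 r1 u2 where "u = u1 + u2" "exec w P s u1 r1" "exec w Q r1 u2 s''"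
    using Seq.prems by (rule exec_elims)
  with Seq.IH show ?case by blast
next
  case (CondTrue b s P t s' Q)
  obtain u1 where "u = tcost b + u1" "exec w P s u1 s''"
    using CondTrue.prems CondTrue.hyps(2) by (auto elim!: exec_elims)
  with CondTrue.IH show ?case by blast
next
  case (CondFalse b s Q t s' P)
  obtain u1 where "u = tcost b + u1" "exec w Q s u1 s''"
    using CondFalse.prems CondFalse.hyps(2) by (auto elim!: exec_elims)
  with CondFalse.IH show ?case by blast
next
  case (WhileFalse b s P)
  then show ?case by (blast elim: exec_While)
next
  case (WhileTrue b s P t1 s1 t2 s2)
  obtain u1 r1 u2 where "u = tcost b + u1 + u2" "exec w P s u1 r1" "exec w (While b P) r1 u2 s''"
    using WhileTrue.prems WhileTrue.hyps(2) by (blast elim: exec_While)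
  with WhileTrue.IH show ?case by blast
qed (auto elim!: exec_elims)

definition halts_within :: "nat \<Rightarrow> prog \<Rightarrow> state \<Rightarrow> real \<Rightarrow> (state \<Rightarrow> bool) \<Rightarrow> bool" where
  "halts_within w P s T Q \<longleftrightarrow> (\<exists>t s'. exec w P s t s' \<and> real t \<le> T \<and> Q s')"

text \<open>For inputs of size parameter \<open>N\<close>, a word length of \<open>k * log 2 (N + 1)\<close> bits suffices. An
  algorithm comes with a constant \<open>k\<close> and has to work for every such word length.\<close>

definition long_words :: "nat \<Rightarrow> nat \<Rightarrow> nat \<Rightarrow> bool" where
  "long_words k N w \<longleftrightarrow> (N + 1) ^ k \<le> 2 ^ w"


section \<open>Matrix multiplication\<close>

text \<open>Matrices are stored row by row.\<close>

definition stores_mat :: "state \<Rightarrow> nat \<Rightarrow> int mat \<Rightarrow> bool" where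
  "stores_mat s x A \<longleftrightarrow>
    (\<forall>i<dim_row A. \<forall>j<dim_col A. arr s x (int (i * dim_col A + j)) = A $$ (i, j))"

definition bounded_mat :: "int \<Rightarrow> int mat \<Rightarrow> bool" where
  "bounded_mat M A \<longleftrightarrow> (\<forall>i<dim_row A. \<forall>j<dim_col A. \<bar>A $$ (i, j)\<bar> \<le> M)"

text \<open>\<open>MM a b c\<close> is a time in which an \<open>a \<times> b\<close> integer matrix can be multiplied by a \<open>b \<times> c\<close> integer
  matrix; the entries have \<open>d * log 2 (a + b + c)\<close> bits.\<close>

definition matmul_time :: "nat \<Rightarrow> (nat \<Rightarrow> nat \<Rightarrow> nat \<Rightarrow> real) \<Rightarrow> bool" where
  "matmul_time d MM \<longleftrightarrow>
    (\<exists>P k. \<forall>w a b c A B s.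
      a \<ge> 1 \<and> b \<ge> 1 \<and> c \<ge> 1 \<and> long_words k (a + b + c) w \<and>
      A \<in> carrier_mat a b \<and> bounded_mat (int (a + b + c) ^ d) A \<and>
      B \<in> carrier_mat b c \<and> bounded_mat (int (a + b + c) ^ d) B \<and>
      word_state w s \<and> var s 0 = int a \<and> var s 1 = int b \<and> var s 2 = int c \<and>
      stores_mat s 0 A \<and> stores_mat s 1 B \<longrightarrow>
      halts_within w P s (MM a b c) (\<lambda>s'. stores_mat s' 2 (A * B)))"


section \<open>Node-Weighted Triangle\<close>

definition simple_graph :: "'v set \<Rightarrow> 'v set set \<Rightarrow> bool" where
  "simple_graph V E \<longleftrightarrow> finite V \<and> (\<forall>e\<in>E. e \<subseteq> V \<and> card e = 2)"

definition zero_triangle :: "'v set set \<Rightarrow> ('v \<Rightarrow> int) \<Rightarrow> bool" where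
  "zero_triangle E wt \<longleftrightarrow>
    (\<exists>x y z. {x, y} \<in> E \<and> {y, z} \<in> E \<and> {x, z} \<in> E \<and> wt x + wt y + wt z = 0)"

text \<open>The graph has vertex set \<open>{..<n}\<close> and is given by its adjacency matrix; the answer is left in
  register 0.\<close>

definition nwt_solvable_in_time :: "(nat \<Rightarrow> real) \<Rightarrow> bool" where
  "nwt_solvable_in_time T \<longleftrightarrow>
    (\<exists>P k. \<forall>w n E wt s.
      n \<ge> 1 \<and> long_words k n w \<and> simple_graph {..<n} E \<and>
      word_state w s \<and> var s 0 = int n \<and>
      stores_mat s 0 (mat n n (\<lambda>(u, v). of_bool ({u, v} \<in> E))) \<and>
      (\<forall>v<n. warr s 0 (int v) = wt v) \<longrightarrow>
      halts_within w P s (T n) (\<lambda>s'. var s' 0 = of_bool (zero_triangle E wt)))"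

end

theory Submission
  imports Defs
begin

text \<open>
  Sort the vertices by weight, so that the vertices of equal weight form intervals. For two weight
  classes \<open>X\<close> and \<open>Y\<close> at most one class \<open>Z\<close> completes the weight to zero, and two pointers find it for
  all pairs in quadratic time. As all three vertices of a triangle range over the same set, only the
  case that \<open>Z\<close> is the smallest of the three classes has to be searched. With \<open>m = |Z|\<close>, split \<open>X\<close> and
  \<open>Y\<close> into blocks of length \<open>m\<close>; every pair of blocks costs one \<open>m \<times> m\<close> product of adjacency matrices,
  that is, time \<open>O(MM m m m)\<close>, which is at most \<open>m\<^sup>2 * (MM n n n / n\<^sup>2)\<close> by monotonicity. The block
  pairs occupy \<open>m\<^sup>2\<close> cells of the \<open>n \<times> n\<close> grid each and cover every cell at most four times, so the sum
  of all \<open>m\<^sup>2\<close> is at most \<open>4 * n\<^sup>2\<close>. The quadratic overhead is absorbed because \<open>MM n n n \<ge> n\<^sup>2\<close>, which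
  monotonicity gives from \<open>MM 1 1 1 \<ge> 1\<close>.
\<close>


section \<open>A weakest-precondition calculus with a time budget\<close>

text \<open>The monotonicity hypothesis concerns square products only. By it, a product of size
  \<open>m\<close> costs at most \<open>f * m\<^sup>2\<close> with
  \<open>f = MM n n n / n\<^sup>2\<close>. This cost can be charged to the cells of an
  \<open>m \<times> m\<close> block, provided such a block fits into \<open>X \<times> Y\<close>; a
  class \<open>Z\<close> larger than \<open>X\<close> or \<open>Y\<close> leaves no room for it. A
  cell determines the weights of its two classes and with them \<open>Z\<close> and
  \<open>m\<close>, so blocks of different class pairs never share a cell. Within one class the only
  overlap is between the last block, moved back to the end of the class, and its predecessor: a
  position lies in at most two blocks, a cell in at most \<open>2 * 2\<close>. The multiplication
  program is unknown and is called many times. It writes finitely many names, and all data that must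
  survive a call lie above them. What a call leaves behind in its own memory is harmless, because
  the program has to be correct on arbitrary contents of uninitialised memory.\<close>

text \<open>The postcondition sees the part of the budget \<open>T\<close> that is left over, which may be negative.\<close>

definition wp :: "nat \<Rightarrow> prog \<Rightarrow> (state \<Rightarrow> real \<Rightarrow> bool) \<Rightarrow> state \<Rightarrow> real \<Rightarrow> bool" where
  "wp w P Q s T \<longleftrightarrow> (\<exists>t s'. exec w P s t s' \<and> Q s' (T - real t))"

lemma wp_Skip: "wp w Skip Q s T \<longleftrightarrow> Q s (T - 1)"
proof
  assume "Q s (T - 1)"
  then show "wp w Skip Q s T" unfolding wp_def by (intro exI[of _ 1] exI[of _ s]) (use exec.Skip[of w s] in simp)
qed (auto simp: wp_def elim!: exec_elims)

lemma wp_Assign: "wp w (Assign x e) Q s T \<longleftrightarrow>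
    wok w e s \<and> Q (s\<lparr>var := (var s)(x := wval e s)\<rparr>) (T - real (wcost e + 1))"
  unfolding wp_def by (rule iffI, (erule exE conjE)+, erule exec_elims(2), simp, blast intro: exec.Assign)

lemma wp_Store: "wp w (Store a i e) Q s T \<longleftrightarrow> wok w i s \<and> wok w e s \<and>
    Q (s\<lparr>arr := (arr s)(a := (arr s a)(wval i s := wval e s))\<rparr>) (T - real (wcost i + wcost e + 1))"
  unfolding wp_def by (rule iffI, (erule exE conjE)+, erule exec_elims(3), simp, blast intro: exec.Store)

lemma wp_WtStore: "wp w (WtStore a i e) Q s T \<longleftrightarrow> wok w i s \<and> wtok w e s \<and>
    Q (s\<lparr>warr := (warr s)(a := (warr s a)(wval i s := wtval e s))\<rparr>) (T - real (wcost i + wtcost e + 1))"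
  unfolding wp_def by (rule iffI, (erule exE conjE)+, erule exec_elims(5), simp, blast intro: exec.WtStore)

lemma wp_Seq: "wp w (Seq P1 P2) Q s T \<longleftrightarrow> wp w P1 (wp w P2 Q) s T"
proof
  assume "wp w (Seq P1 P2) Q s T"
  then obtain t1 t2 s1 s2 where "exec w P1 s t1 s1" "exec w P2 s1 t2 s2" "Q s2 (T - real (t1 + t2))"
    unfolding wp_def by (blast elim: exec_elims)
  then show "wp w P1 (wp w P2 Q) s T"
    unfolding wp_def by (metis diff_diff_eq of_nat_add)
next
  assume "wp w P1 (wp w P2 Q) s T"
  then obtain t1 t2 s1 s2 where "exec w P1 s t1 s1" "exec w P2 s1 t2 s2" "Q s2 (T - real t1 - real t2)"
    unfolding wp_def by blast
  then show "wp w (Seq P1 P2) Q s T"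
    unfolding wp_def by (metis exec.Seq diff_diff_eq of_nat_add)
qed

lemma wp_Cond: "wp w (Cond b P1 P2) Q s T \<longleftrightarrow>
    tok w b s \<and> (if tval b s then wp w P1 Q s (T - real (tcost b)) else wp w P2 Q s (T - real (tcost b)))"
proof
  assume "wp w (Cond b P1 P2) Q s T"
  then obtain t s' where "exec w (Cond b P1 P2) s t s'" "Q s' (T - real t)"
    unfolding wp_def by blast
  then show "tok w b s \<and> (if tval b s then wp w P1 Q s (T - real (tcost b)) else wp w P2 Q s (T - real (tcost b)))"
    by (elim exec_elims) (auto simp: wp_def diff_diff_eq)
next
  assume *: "tok w b s \<and> (if tval b s then wp w P1 Q s (T - real (tcost b)) else wp w P2 Q s (T - real (tcost b)))"
  then obtain t s' where "exec w (if tval b s then P1 else P2) s t s'" "Q s' (T - real (tcost b) - real t)"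
    unfolding wp_def by (auto split: if_splits)
  with * show "wp w (Cond b P1 P2) Q s T"
    unfolding wp_def by (metis exec.CondTrue exec.CondFalse diff_diff_eq of_nat_add)
qed

lemmas wp_simps = wp_Skip wp_Assign wp_Store wp_WtStore wp_Seq wp_Cond

abbreviation (input) in_time :: "(state \<Rightarrow> bool) \<Rightarrow> state \<Rightarrow> real \<Rightarrow> bool" where
  "in_time Q \<equiv> \<lambda>s r. 0 \<le> r \<and> Q s"

text \<open>Straight-line code is discharged by rewriting with \<open>wp_simps\<close>; loops and
  calls are specified by \<open>halts_within\<close> and composed by the rules below.\<close>

lemma halts_within_wp: "halts_within w P s T Q \<longleftrightarrow> wp w P (in_time Q) s T"
  unfolding wp_def halts_within_def by auto

lemma tcost_pos: "tcost b \<ge> 1"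
  by (cases b) auto

text \<open>The source of \<open>1 \<le> MM 1 1 1\<close>, and through it of the bound
  \<open>1 \<le> f\<close> that absorbs the quadratic overhead.\<close>

lemma exec_pos: "exec w P s t s' \<Longrightarrow> t \<ge> 1"
proof (induction rule: exec.induct)
  case (WhileFalse b s P)
  show ?case by (rule tcost_pos)
qed auto

lemma wok_word: "wok w e s \<Longrightarrow> is_word w (wval e s)"
  by (cases e) auto

text \<open>A location can be read only if it holds a word. Invariance supplies this for memory
  about which nothing else is known, such as the result of a call.\<close>

lemma exec_word_state: "exec w P s t s' \<Longrightarrow> word_state w s \<Longrightarrow> word_state w s'"
  by (induction rule: exec.induct) (auto simp: word_state_def wok_word)

section \<open>Frames\<close>

fun wr_var :: "prog \<Rightarrow> nat set" where
  "wr_var (Assign x e) = {x}"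
| "wr_var (Seq P Q) = wr_var P \<union> wr_var Q"
| "wr_var (Cond b P Q) = wr_var P \<union> wr_var Q"
| "wr_var (While b P) = wr_var P"
| "wr_var _ = {}"

fun wr_arr :: "prog \<Rightarrow> nat set" where
  "wr_arr (Store a i e) = {a}"
| "wr_arr (Seq P Q) = wr_arr P \<union> wr_arr Q"
| "wr_arr (Cond b P Q) = wr_arr P \<union> wr_arr Q"
| "wr_arr (While b P) = wr_arr P"
| "wr_arr _ = {}"

fun wr_warr :: "prog \<Rightarrow> nat set" where
  "wr_warr (WtStore a i e) = {a}"
| "wr_warr (Seq P Q) = wr_warr P \<union> wr_warr Q"
| "wr_warr (Cond b P Q) = wr_warr P \<union> wr_warr Q"
| "wr_warr (While b P) = wr_warr P"
| "wr_warr _ = {}"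

text \<open>Based on syntactic write sets, so it applies to an arbitrary program as well. Weight
  registers are left out, since all weights here are kept in arrays.\<close>

definition agree :: "prog \<Rightarrow> state \<Rightarrow> state \<Rightarrow> bool" where
  "agree P s s' \<longleftrightarrow> (\<forall>x. x \<notin> wr_var P \<longrightarrow> var s' x = var s x) \<and>
     (\<forall>x. x \<notin> wr_arr P \<longrightarrow> arr s' x = arr s x) \<and> (\<forall>x. x \<notin> wr_warr P \<longrightarrow> warr s' x = warr s x)"

lemma agree_refl: "agree P s s"
  by (simp add: agree_def)

lemma exec_agree: "exec w P s t s' \<Longrightarrow> agree P s s'"
  by (induction rule: exec.induct) (auto simp: agree_def)

lemma finite_writes: "finite (wr_var P)" "finite (wr_arr P)" "finite (wr_warr P)"
  by (induction P) auto

lemma halts_within_frame: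
  assumes "halts_within w P s T Q" "word_state w s"
  shows "halts_within w P s T (\<lambda>s'. Q s' \<and> agree P s s' \<and> word_state w s')"
  using assms exec_agree exec_word_state unfolding halts_within_def by blast

lemma halts_within_mono:
  assumes "halts_within w P s T Q" "T \<le> T'" "\<And>s'. Q s' \<Longrightarrow> Q' s'"
  shows "halts_within w P s T' Q'"
  using assms unfolding halts_within_def by force

text \<open>Lets a loop specified by \<open>halts_within\<close> occur inside a weakest
  precondition. Its time is known only up to an upper bound, so the continuation must cope with
  every remainder \<open>r \<ge> B - T\<close>.\<close>

lemma wp_halts_within:
  assumes "halts_within w P s T Q" "word_state w s"
    and "\<And>s' r. Q s' \<Longrightarrow> agree P s s' \<Longrightarrow> word_state w s' \<Longrightarrow> r \<ge> B - T \<Longrightarrow> R s' r"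
  shows "wp w P R s B"
proof -
  obtain t s' where *: "exec w P s t s'" "real t \<le> T" "Q s'"
    using assms(1) unfolding halts_within_def by blast
  then have "R s' (B - real t)"
    using exec_agree exec_word_state assms(2) by (intro assms(3)) auto
  with * show ?thesis unfolding wp_def by blast
qed

lemma halts_within_Seq:
  assumes "halts_within w P s T1 Q" "word_state w s"
    and "\<And>s'. Q s' \<Longrightarrow> agree P s s' \<Longrightarrow> word_state w s' \<Longrightarrow> halts_within w P' s' T2 R"
    and "T1 + T2 \<le> T"
  shows "halts_within w (Seq P P') s T R"
proof -
  obtain t s' where 1: "exec w P s t s'" "real t \<le> T1" "Q s'"
    using assms(1) unfolding halts_within_def by blast
  moreover have "halts_within w P' s' T2 R"
    using 1 exec_agree exec_word_state assms(2) by (intro assms(3)) auto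
  ultimately show ?thesis
    using assms(4) unfolding halts_within_def by (force intro: exec.Seq)
qed
lemma halts_within_CondTrue:
  assumes "tok w b s" "tval b s" "halts_within w P s T1 Q" "real (tcost b) + T1 \<le> T"
  shows "halts_within w (Cond b P P') s T Q"
proof -
  obtain t s' where "exec w P s t s'" "real t \<le> T1" "Q s'"
    using assms(3) unfolding halts_within_def by blast
  with assms show ?thesis
    unfolding halts_within_def by (force intro: exec.CondTrue)
qed


section \<open>Loops\<close>

text \<open>At most \<open>m s\<close> rounds take place, each paying \<open>K\<close> and one test;
  the last summand is the failing test. Test and body are examined only in states that agree with
  \<open>s\<close> off the written names, so constant registers and tables need not be repeated in
  \<open>I\<close>.\<close>

lemma halts_within_While_measure:
  fixes m :: "state \<Rightarrow> nat"
  assumes "word_state w s" "I s" "0 \<le> K"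
    and tok: "\<And>s'. I s' \<Longrightarrow> agree P s s' \<Longrightarrow> tok w b s'"
    and body: "\<And>s'. I s' \<Longrightarrow> agree P s s' \<Longrightarrow> word_state w s' \<Longrightarrow> tval b s' \<Longrightarrow>
      halts_within w P s' K (\<lambda>s''. I s'' \<and> m s'' < m s')"
  shows "halts_within w (While b P) s (real (m s) * (K + real (tcost b)) + real (tcost b))
    (\<lambda>s'. I s' \<and> \<not> tval b s')"
proof -
  have "halts_within w (While b P) s' (real (m s') * (K + real (tcost b)) + real (tcost b))
      (\<lambda>s'. I s' \<and> \<not> tval b s')" if "I s'" "agree P s s'" "word_state w s'" for s'
    using that
  proof (induction "m s'" arbitrary: s' rule: less_induct)
    case less
    show ?case
    proof (cases "tval b s'")
      case True
      obtain t1 s1 where 1: "exec w P s' t1 s1" "real t1 \<le> K" "I s1" "m s1 < m s'"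
        using body[OF less.prems True] unfolding halts_within_def by blast
      have "agree P s s1"
        using less.prems(2) exec_agree[OF 1(1)] by (simp add: agree_def)
      then obtain t2 s2 where 2: "exec w (While b P) s1 t2 s2"
        "real t2 \<le> real (m s1) * (K + real (tcost b)) + real (tcost b)" "I s2" "\<not> tval b s2"
        using less.hyps[OF 1(4) 1(3)] exec_word_state[OF 1(1)] less.prems
        unfolding halts_within_def by blast
      have "real (m s1) + 1 \<le> real (m s')" using 1(4) by linarith
      then have "(real (m s1) + 1) * (K + real (tcost b)) \<le> real (m s') * (K + real (tcost b))"
        using assms(3) by (intro mult_right_mono) auto
      then have "real (tcost b + t1 + t2) \<le> real (m s') * (K + real (tcost b)) + real (tcost b)"
        using 1(2) 2(2) by (simp add: algebra_simps)
      with True 1 2 tok less.prems exec.WhileTrue show ?thesis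
        unfolding halts_within_def by blast
    next
      case False
      have "exec w (While b P) s' (tcost b) s'"
        using tok less.prems False by (intro exec.WhileFalse) auto
      moreover have "real (tcost b) \<le> real (m s') * (K + real (tcost b)) + real (tcost b)"
        using assms(3) by simp
      ultimately show ?thesis using False less.prems unfolding halts_within_def by blast
    qed
  qed
  then show ?thesis using assms(1,2) agree_refl by blast
qed

text \<open>The bound \<open>y\<close> is a register and must not be changed by the body.\<close>

definition For :: "nat \<Rightarrow> nat \<Rightarrow> prog \<Rightarrow> prog" where
  "For x y P = Seq (Assign x (Lit 0))
     (While (Less (Var x) (Var y)) (Seq P (Assign x (Bin Add (Var x) (Lit 1)))))"

lemma wr_For [simp]:
  "wr_var (For x y P) = insert x (wr_var P)" "wr_arr (For x y P) = wr_arr P"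
  "wr_warr (For x y P) = wr_warr P"
  by (auto simp: For_def)

text \<open>Each round pays 3 for the test and 4 for the increment; the final 5 is the initial
  assignment plus the failing test. \<open>stable\<close> is required because the counter changes
  after the body has established \<open>I (Suc i)\<close>; its value reaches the body as a separate
  assumption.\<close>

lemma halts_within_For:
  assumes "word_state w s" "var s y = int k" "x \<noteq> y" "x \<notin> wr_var P" "y \<notin> wr_var P"
    and stable: "\<And>i s' v. I i s' \<Longrightarrow> I i (s'\<lparr>var := (var s')(x := v)\<rparr>)"
    and init: "I 0 s"
    and body: "\<And>i s'. i < k \<Longrightarrow> I i s' \<Longrightarrow> var s' x = int i \<Longrightarrow> agree (For x y P) s s' \<Longrightarrow>
      word_state w s' \<Longrightarrow> halts_within w P s' (T i) (I (Suc i))"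
  shows "halts_within w (For x y P) s ((\<Sum>i<k. T i) + 7 * real k + 5) (I k)"
proof -
  let ?b = "Less (Var x) (Var y)" and ?body = "Seq P (Assign x (Bin Add (Var x) (Lit 1)))"
  \<comment> \<open>The bound is a word because a register holds it; the counter never exceeds it
    and so never overflows.\<close>
  have kw: "is_word w (int k)" using assms(1,2) unfolding word_state_def by metis
  have *: "halts_within w (While ?b ?body) s' ((\<Sum>j=i..<k. T j) + 7 * real (k - i) + 3) (I k)"
    if "i \<le> k" "I i s'" "var s' x = int i" "agree (For x y P) s s'" "word_state w s'" for i s'
    using that
  proof (induction "k - i" arbitrary: i s')
    case 0
    then have "i = k" by simp
    moreover have "var s' y = int k" using assms 0 by (simp add: agree_def)
    moreover have "tok w ?b s'" using \<open>word_state w s'\<close> by (simp add: word_state_def)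
    ultimately have "exec w (While ?b ?body) s' (tcost ?b) s'"
      using 0 by (intro exec.WhileFalse) auto
    then show ?case using 0 \<open>i = k\<close> unfolding halts_within_def by force
  next
    case (Suc l)
    then have "i < k" by simp
    have y: "var s' y = int k" using assms Suc.prems by (simp add: agree_def)
    have tok: "tok w ?b s'" using \<open>word_state w s'\<close> by (simp add: word_state_def)
    obtain t1 s1 where 1: "exec w P s' t1 s1" "real t1 \<le> T i" "I (Suc i) s1"
      using body[OF \<open>i < k\<close>] Suc.prems unfolding halts_within_def by blast
    have ag: "agree P s' s1" and ws: "word_state w s1"
      using exec_agree[OF 1(1)] exec_word_state[OF 1(1)] Suc.prems by auto
    have x1: "var s1 x = int i" using ag Suc.prems assms(4) by (simp add: agree_def)
    let ?s2 = "s1\<lparr>var := (var s1)(x := int i + 1)\<rparr>"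
    have lit: "is_word w 1" "is_word w (int i + 1)" "is_word w (int i)"
      using kw \<open>i < k\<close> zero_le_power[of "2::int" w] unfolding is_word_def by linarith+
    have e2: "exec w (Assign x (Bin Add (Var x) (Lit 1))) s1 4 ?s2"
      using exec.Assign[of w "Bin Add (Var x) (Lit 1)" s1 x] x1 lit ws[unfolded word_state_def]
      by (auto simp: eval_nat_numeral)
    then have e: "exec w ?body s' (t1 + 4) ?s2" by (rule exec.Seq[OF 1(1)])
    have "halts_within w (While ?b ?body) ?s2 ((\<Sum>j=Suc i..<k. T j) + 7 * real (k - Suc i) + 3) (I k)"
    proof (rule Suc.hyps)
      show "agree (For x y P) s ?s2"
        using Suc.prems(4) ag assms by (auto simp: agree_def)
      show "word_state w ?s2" using ws lit by (auto simp: word_state_def)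
      show "I (Suc i) ?s2" by (rule stable[OF 1(3)])
    qed (use Suc.hyps(2) \<open>i < k\<close> in auto)
    then obtain t2 s2 where 2: "exec w (While ?b ?body) ?s2 t2 s2"
      "real t2 \<le> (\<Sum>j=Suc i..<k. T j) + 7 * real (k - Suc i) + 3" "I k s2"
      unfolding halts_within_def by blast
    have "exec w (While ?b ?body) s' (tcost ?b + (t1 + 4) + t2) s2"
      by (rule exec.WhileTrue[OF tok _ e 2(1)]) (use y Suc.prems(3) \<open>i < k\<close> in simp)
    moreover have "real (tcost ?b + (t1 + 4) + t2) \<le> (\<Sum>j=i..<k. T j) + 7 * real (k - i) + 3"
    proof -
      have "(\<Sum>j=i..<k. T j) = T i + (\<Sum>j=Suc i..<k. T j)"
        using \<open>i < k\<close> by (rule sum.atLeast_Suc_lessThan)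
      moreover have "real (k - i) = real (k - Suc i) + 1"
        using \<open>i < k\<close> by simp
      ultimately show ?thesis using 1(2) 2(2) by simp
    qed
    ultimately show ?case using 2(3) unfolding halts_within_def by (intro exI conjI)
  qed
  have "is_word w 0" by (simp add: is_word_def)
  have "halts_within w (While ?b ?body) (s\<lparr>var := (var s)(x := 0)\<rparr>)
      ((\<Sum>j=0..<k. T j) + 7 * real (k - 0) + 3) (I k)"
    by (rule *) (use assms(1) init stable \<open>is_word w 0\<close> in \<open>auto simp: agree_def word_state_def\<close>)
  then obtain t2 s2 where 2: "exec w (While ?b ?body) (s\<lparr>var := (var s)(x := 0)\<rparr>) t2 s2"
      "real t2 \<le> (\<Sum>j=0..<k. T j) + 7 * real k + 3" "I k s2"
    unfolding halts_within_def by auto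
  have "exec w (Assign x (Lit 0)) s 2 (s\<lparr>var := (var s)(x := 0)\<rparr>)"
    using exec.Assign[of w "Lit 0" s x] \<open>is_word w 0\<close> by (simp add: numeral_2_eq_2)
  from exec.Seq[OF this 2(1)] have "exec w (For x y P) s (2 + t2) s2" unfolding For_def .
  then show ?thesis using 2(2,3) unfolding halts_within_def
    by (intro exI[of _ "2 + t2"] exI[of _ s2]) (simp add: atLeast0LessThan)
qed

lemma halts_within_For_const:
  assumes "word_state w s" "var s y = int k" "x \<noteq> y" "x \<notin> wr_var P" "y \<notin> wr_var P"
    and "\<And>i s' v. I i s' \<Longrightarrow> I i (s'\<lparr>var := (var s')(x := v)\<rparr>)"
    and "I 0 s"
    and "\<And>i s'. i < k \<Longrightarrow> I i s' \<Longrightarrow> var s' x = int i \<Longrightarrow> agree (For x y P) s s' \<Longrightarrow>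
      word_state w s' \<Longrightarrow> halts_within w P s' K (I (Suc i))"
    and "real k * K + 7 * real k + 5 \<le> T"
    and "\<And>s'. I k s' \<Longrightarrow> Q s'"
  shows "halts_within w (For x y P) s T Q"
proof -
  have "halts_within w (For x y P) s ((\<Sum>i<k. K) + 7 * real k + 5) (I k)"
  proof (rule halts_within_For)
    show "I i (s'\<lparr>var := (var s')(x := v)\<rparr>)" if "I i s'" for i s' v
      using assms(6) that .
    show "halts_within w P s' K (I (Suc i))"
      if "i < k" "I i s'" "var s' x = int i" "agree (For x y P) s s'" "word_state w s'" for i s'
      using assms(8) that .
  qed (use assms in auto)
  then show ?thesis
    by (rule halts_within_mono) (use assms(9,10) in auto)
qed


section \<open>Sorting the vertices\<close>

text \<open>Ties are broken by the index, which makes \<open>rank\<close> injective and hence a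
  permutation of \<open>{..<n}\<close>. Sorting by counting predecessors is quadratic, which is
  affordable here.\<close>

definition rank :: "nat \<Rightarrow> (nat \<Rightarrow> int) \<Rightarrow> nat \<Rightarrow> nat" where
  "rank n wt v = card {u. u < n \<and> (wt u < wt v \<or> wt u = wt v \<and> u < v)}"

lemma rank_less: "v < n \<Longrightarrow> rank n wt v < n"
  using psubset_card_mono[of "{..<n}" "{u. u < n \<and> (wt u < wt v \<or> wt u = wt v \<and> u < v)}"]
  by (auto simp: rank_def)

lemma rank_strict_mono:
  assumes "u < n" "wt u < wt v \<or> wt u = wt v \<and> u < v"
  shows "rank n wt u < rank n wt v"
  unfolding rank_def by (rule psubset_card_mono) (use assms in auto)

lemma rank_inj: "inj_on (rank n wt) {..<n}"
proof (rule inj_onI)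
  fix u v assume "u \<in> {..<n}" "v \<in> {..<n}" "rank n wt u = rank n wt v"
  then show "u = v"
    using rank_strict_mono[of u n wt v] rank_strict_mono[of v n wt u] by force
qed

lemma rank_bij: "bij_betw (rank n wt) {..<n} {..<n}"
proof -
  have "rank n wt ` {..<n} = {..<n}"
    by (rule card_subset_eq) (auto simp: rank_less card_image rank_inj)
  then show ?thesis using rank_inj by (simp add: bij_betw_def)
qed

definition sorted_vertex :: "nat \<Rightarrow> (nat \<Rightarrow> int) \<Rightarrow> nat \<Rightarrow> nat" where
  "sorted_vertex n wt = inv_into {..<n} (rank n wt)"

lemma sorted_vertex_bij: "bij_betw (sorted_vertex n wt) {..<n} {..<n}"
  unfolding sorted_vertex_def by (rule bij_betw_inv_into[OF rank_bij])

lemma sorted_vertex_less: "i < n \<Longrightarrow> sorted_vertex n wt i < n"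
  using sorted_vertex_bij[of n wt] by (auto simp: bij_betw_def)

lemma rank_sorted_vertex: "i < n \<Longrightarrow> rank n wt (sorted_vertex n wt i) = i"
  unfolding sorted_vertex_def using rank_bij[of n wt] by (metis bij_betw_inv_into_right lessThan_iff)

lemma sorted_vertex_mono:
  assumes "i \<le> j" "j < n"
  shows "wt (sorted_vertex n wt i) \<le> wt (sorted_vertex n wt j)"
proof (rule ccontr)
  assume "\<not> ?thesis"
  then have "rank n wt (sorted_vertex n wt j) < rank n wt (sorted_vertex n wt i)"
    using assms by (intro rank_strict_mono sorted_vertex_less) auto
  then show False using assms by (simp add: rank_sorted_vertex)
qed


text \<open>
  All names from \<open>b\<close> on belong to our program, so that a matrix multiplication program that only writes
  smaller names can be called as a subroutine. The registers are \<open>b\<close> for \<open>n\<close>, \<open>b + 1\<close> and \<open>b + 2\<close> for the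
  current pair \<open>x, y\<close> of vertices, \<open>b + 3\<close> and \<open>b + 4\<close> for auxiliary values (in the main loop the start
  and the size of the third weight class), \<open>b + 5\<close> and \<open>b + 6\<close> for the corner of the current block,
  \<open>b + 7\<close> and \<open>b + 8\<close> for loops inside a block, and \<open>b + 9\<close> for the answer. The arrays are \<open>b\<close> for the
  sorted adjacency matrix, \<open>b + 1\<close> for the sorted vertices, \<open>b + 2\<close> and \<open>b + 3\<close> for the bounds of the
  weight classes and \<open>b + 4\<close> for the table \<open>first\<close>; the sorted weights are in the weight array \<open>b\<close>.
\<close>

locale ram =
  fixes w n b :: nat
  assumes b_ge: "3 \<le> b" and n_pos: "1 \<le> n" and wide: "4 * (n + 1)\<^sup>2 \<le> 2 ^ w"
begin

text \<open>The range of all words computed by the program's own code: matrix indices stay below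
  \<open>n\<^sup>2\<close>, a position plus a block length below \<open>2 * n\<close>, and
  \<open>- 1\<close> arises when the two-pointer search looks to the left of position 0.\<close>

lemma is_wordI: "- 1 \<le> x \<Longrightarrow> x \<le> (int n + 1)\<^sup>2 \<Longrightarrow> is_word w x"
proof -
  assume x: "- 1 \<le> x" "x \<le> (int n + 1)\<^sup>2"
  have "int (4 * (n + 1)\<^sup>2) \<le> int (2 ^ w)" using wide by (simp only: of_nat_le_iff)
  then have "4 * (int n + 1)\<^sup>2 \<le> 2 ^ w" by (simp add: add.commute)
  moreover have "1 \<le> (int n + 1)\<^sup>2" by simp
  ultimately show ?thesis using x unfolding is_word_def by linarith
qed

lemma square_bound: "int n \<le> (int n + 1)\<^sup>2" "int n + 1 \<le> (int n + 1)\<^sup>2" "int n * 2 \<le> (int n + 1)\<^sup>2"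
  "int n * int n \<le> (int n + 1)\<^sup>2" "3 \<le> (int n + 1)\<^sup>2"
proof -
  have "1 * 1 \<le> int n * int n" using n_pos by (intro mult_mono) auto
  then show "int n \<le> (int n + 1)\<^sup>2" "int n + 1 \<le> (int n + 1)\<^sup>2" "int n * 2 \<le> (int n + 1)\<^sup>2"
    "int n * int n \<le> (int n + 1)\<^sup>2" "3 \<le> (int n + 1)\<^sup>2"
    using n_pos by (auto simp: power2_eq_square algebra_simps)
qed

lemma is_word_simps [simp]:
  "is_word w 0" "is_word w 1" "is_word w (int n)" "is_word w (int n + 1)"
  using square_bound by (auto intro!: is_wordI)

lemma is_word_nat: "i \<le> n \<Longrightarrow> is_word w (int i)"
  using square_bound by (intro is_wordI) auto

lemma is_word_index:
  assumes "i < k" "j < k" "k \<le> n"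
  shows "is_word w (int i * int k + int j)" "is_word w (int i * int k)"
proof -
  have "i * k + j < k * k" using mult_le_mono1[of "Suc i" k k] assms by simp
  then have "int (i * k + j) < int (k * k)" by (simp only: of_nat_less_iff)
  moreover have "int (k * k) \<le> int (n * n)" using assms(3) by (simp only: of_nat_le_iff mult_le_mono)
  ultimately have le: "int i * int k + int j \<le> (int n + 1)\<^sup>2"
    using square_bound(4) by simp
  have ge: "0 \<le> int i * int k" by simp
  show "is_word w (int i * int k + int j)" "is_word w (int i * int k)"
    by (rule is_wordI; use le ge in linarith)+
qed

lemma square_real: "real n \<le> (real n)\<^sup>2" "1 \<le> (real n)\<^sup>2"
proof -
  have "1 * 1 \<le> real n * real n" using n_pos by (intro mult_mono) auto
  then show "real n \<le> (real n)\<^sup>2" "1 \<le> (real n)\<^sup>2" using n_pos by (auto simp: power2_eq_square)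
qed

text \<open>The test is the disjunction from \<open>rank\<close>, written with negations because
  \<open>test\<close> offers only \<open>Conj\<close> and \<open>Neg\<close>.\<close>

definition rank_step :: prog where
  "rank_step = Cond (Neg (Conj (Neg (WtLess (WtArr 0 (Var (b + 2))) (WtArr 0 (Var (b + 1)))))
      (Neg (Conj (WtEq (WtArr 0 (Var (b + 2))) (WtArr 0 (Var (b + 1)))) (Less (Var (b + 2)) (Var (b + 1)))))))
    (Assign (b + 3) (Bin Add (Var (b + 3)) (Lit 1))) Skip"

definition rank_prog :: prog where
  "rank_prog = For (b + 1) b (Seq (Assign (b + 3) (Lit 0)) (Seq (For (b + 2) b rank_step)
     (Seq (Store (b + 1) (Var (b + 3)) (Var (b + 1))) (WtStore b (Var (b + 3)) (WtArr 0 (Var (b + 1)))))))"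

lemma card_less_Suc:
  "card {u. u < Suc i \<and> P u} = card {u. u < i \<and> P u} + (if P i then 1 else 0)"
proof -
  have "{u. u < Suc i \<and> P u} = (if P i then insert i {u. u < i \<and> P u} else {u. u < i \<and> P u})"
    by (auto simp: less_Suc_eq)
  then show ?thesis by simp
qed

lemma card_less_le: "card {u. u < i \<and> P u} \<le> i"
  using card_mono[of "{..<i}" "{u. u < i \<and> P u}"] by auto

lemma rank_loop:
  assumes "word_state w s" "var s b = int n" "\<forall>v<n. warr s 0 (int v) = wt v"
    "var s (b + 1) = int x" "x < n" "var s (b + 3) = 0"
  shows "halts_within w (For (b + 2) b rank_step) s (30 * real n + 5)
    (\<lambda>s'. var s' (b + 3) = int (rank n wt x))"
proof (rule halts_within_For_const[where K = 23 and k = n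
    and I = "\<lambda>i s'. var s' (b + 3) = int (card {u. u < i \<and> (wt u < wt x \<or> wt u = wt x \<and> u < x)})"])
  fix i s'
  assume i: "i < n"
    and I: "var s' (b + 3) = int (card {u. u < i \<and> (wt u < wt x \<or> wt u = wt x \<and> u < x)})"
    and y: "var s' (b + 2) = int i" and ag: "agree (For (b + 2) b rank_step) s s'"
  have s': "var s' (b + 1) = int x" "warr s' 0 = warr s 0"
    using ag assms by (auto simp: agree_def rank_step_def)
  have "card {u. u < i \<and> (wt u < wt x \<or> wt u = wt x \<and> u < x)} < n"
    using card_less_le[of i] i by (rule order.strict_trans1)
  then have wd: "is_word w (int (card {u. u < i \<and> (wt u < wt x \<or> wt u = wt x \<and> u < x)}))"
    "is_word w (int (card {u. u < i \<and> (wt u < wt x \<or> wt u = wt x \<and> u < x)}) + 1)"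
    using square_bound by (auto intro!: is_wordI)
  show "halts_within w rank_step s' 23 (\<lambda>s'. var s' (b + 3) =
      int (card {u. u < Suc i \<and> (wt u < wt x \<or> wt u = wt x \<and> u < x)}))"
    unfolding halts_within_wp rank_step_def card_less_Suc
    using i I y s' wd assms by (auto simp: wp_simps is_word_nat)
qed (use assms in \<open>auto simp: rank_step_def rank_def\<close>)


lemma rank_prog:
  assumes "word_state w s" "var s b = int n" "\<forall>v<n. warr s 0 (int v) = wt v"
  shows "halts_within w rank_prog s (70 * (real n)\<^sup>2)
    (\<lambda>s'. \<forall>v<n. arr s' (b + 1) (int (rank n wt v)) = int v \<and> warr s' b (int (rank n wt v)) = wt v)"
  unfolding rank_prog_def
proof (rule halts_within_For_const[where K = "30 * real n + 20" and k = n
    and I = "\<lambda>i s'. \<forall>v<i. arr s' (b + 1) (int (rank n wt v)) = int v \<and> warr s' b (int (rank n wt v)) = wt v"])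
  let ?I = "\<lambda>i s'. \<forall>v<i. arr s' (b + 1) (int (rank n wt v)) = int v \<and> warr s' b (int (rank n wt v)) = wt v"
  let ?body = "Seq (Assign (b + 3) (Lit 0)) (Seq (For (b + 2) b rank_step)
     (Seq (Store (b + 1) (Var (b + 3)) (Var (b + 1))) (WtStore b (Var (b + 3)) (WtArr 0 (Var (b + 1))))))"
  fix i s'
  assume i: "i < n" and I: "?I i s'" and x: "var s' (b + 1) = int i"
    and ag: "agree (For (b + 1) b ?body) s s'" and ws: "word_state w s'"
  have s': "var s' b = int n" "warr s' 0 = warr s 0"
    using ag assms b_ge by (auto simp: agree_def rank_step_def)
  have "wp w (For (b + 2) b rank_step) (wp w (Seq (Store (b + 1) (Var (b + 3)) (Var (b + 1)))
      (WtStore b (Var (b + 3)) (WtArr 0 (Var (b + 1))))) (in_time (?I (Suc i))))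
      (s'\<lparr>var := (var s')(b + 3 := 0)\<rparr>) (18 + 30 * real n)"
  proof (rule wp_halts_within[OF rank_loop[where wt = wt and x = i]])
    fix s2 r
    assume r: "var s2 (b + 3) = int (rank n wt i)"
      and ag2: "agree (For (b + 2) b rank_step) (s'\<lparr>var := (var s')(b + 3 := 0)\<rparr>) s2"
      and le: "18 + 30 * real n - (30 * real n + 5) \<le> r"
    have s2: "var s2 (b + 1) = int i" "warr s2 = warr s'" "arr s2 = arr s'"
      using ag2 x by (auto simp: agree_def rank_step_def)
    \<comment> \<open>Ranks are distinct, so the stores for \<open>i\<close> do not overwrite those
      of earlier vertices.\<close>
    have ne: "rank n wt v \<noteq> rank n wt i" if "v < i" for v
      using rank_inj[of n wt] that i by (auto simp: inj_on_def)
    have "is_word w (int (rank n wt i))" "is_word w (int i)" "7 \<le> r"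
      using rank_less[OF i, of wt] i le by (auto intro: is_word_nat)
    then show "wp w (Seq (Store (b + 1) (Var (b + 3)) (Var (b + 1)))
      (WtStore b (Var (b + 3)) (WtArr 0 (Var (b + 1))))) (in_time (?I (Suc i))) s2 r"
      using i I assms(3) s' b_ge ne r s2 by (simp add: wp_simps less_Suc_eq all_conj_distrib)
  qed (use ws x s' assms i in \<open>auto simp: word_state_def\<close>)
  then show "halts_within w ?body s' (30 * real n + 20) (?I (Suc i))"
    by (simp add: halts_within_wp wp_simps(2,5))
next
  show "real n * (30 * real n + 20) + 7 * real n + 5 \<le> 70 * (real n)\<^sup>2"
    using square_real by (simp add: power2_eq_square algebra_simps)
qed (use assms in \<open>auto simp: rank_step_def\<close>)

end


section \<open>Tables\<close>

lemma index_inj: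
  assumes "j < k" "j' < k"
  shows "int i * int k + int j = int i' * int k + int j' \<longleftrightarrow> i = i' \<and> j = j'"
proof
  assume "int i * int k + int j = int i' * int k + int j'"
  then have *: "i * k + j = i' * k + j'" by (simp only: of_nat_mult[symmetric] of_nat_add[symmetric] of_nat_eq_iff)
  have "i = (i * k + j) div k" "i' = (i' * k + j') div k" using assms by simp_all
  with * have "i = i'" by metis
  with * show "i = i' \<and> j = j'" by simp
qed auto

text \<open>A downward closed subset of \<open>{..<n}\<close> is an initial segment, so its size is
  the position where it ends. This turns the counting definitions of \<open>first\<close>,
  \<open>lo\<close> and \<open>hi\<close> into comparisons of positions.\<close>

lemma card_less_downward_closed:
  assumes "\<And>i j. i \<le> j \<Longrightarrow> j < n \<Longrightarrow> P j \<Longrightarrow> P i" "j < (n::nat)"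
  shows "j < card {z. z < n \<and> P z} \<longleftrightarrow> P j"
proof
  assume "P j"
  then have "{..j} \<subseteq> {z. z < n \<and> P z}" using assms by auto
  from card_mono[OF _ this] show "j < card {z. z < n \<and> P z}" by simp
next
  assume *: "j < card {z. z < n \<and> P z}"
  show "P j"
  proof (rule ccontr)
    assume "\<not> P j"
    then have "z < j" if "z < n" "P z" for z
      using assms(1)[of j z] that by (cases "j \<le> z") auto
    then have "{z. z < n \<and> P z} \<subseteq> {..<j}" by auto
    from card_mono[OF _ this] * show False by simp
  qed
qed

context ram
begin

definition fill :: "nat \<Rightarrow> nat \<Rightarrow> nat \<Rightarrow> nat \<Rightarrow> wexp \<Rightarrow> prog" where
  "fill x y z a e = For x z (For y z (Store a (Bin Add (Bin Mul (Var x) (Var z)) (Var y)) e))"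

lemma wr_fill [simp]:
  "wr_var (fill x y z a e) = {x, y}" "wr_arr (fill x y z a e) = {a}" "wr_warr (fill x y z a e) = {}"
  by (auto simp: fill_def)

text \<open>The expression is judged in any state that agrees with \<open>s\<close> off the written
  names, so \<open>e\<close> can rely on every array except \<open>a\<close>.\<close>

lemma fill:
  assumes "word_state w s" "var s z = int k" "1 \<le> k" "k \<le> n" "x \<noteq> y" "x \<noteq> z" "y \<noteq> z"
    and e: "\<And>i j s'. i < k \<Longrightarrow> j < k \<Longrightarrow> var s' x = int i \<Longrightarrow> var s' y = int j \<Longrightarrow>
      agree (fill x y z a e) s s' \<Longrightarrow> wok w e s' \<and> wval e s' = g i j"
  shows "halts_within w (fill x y z a e) s (real (wcost e + 40) * (real k)\<^sup>2)
    (\<lambda>s'. \<forall>i<k. \<forall>j<k. arr s' a (int i * int k + int j) = g i j)"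
  unfolding fill_def
proof (rule halts_within_For_const[where k = k and K = "real (wcost e + 13) * real k + 5"
    and I = "\<lambda>i s'. \<forall>u<i. \<forall>v<k. arr s' a (int u * int k + int v) = g u v"])
  let ?row = "For y z (Store a (Bin Add (Bin Mul (Var x) (Var z)) (Var y)) e)"
  fix i s'
  assume i: "i < k" and I: "\<forall>u<i. \<forall>v<k. arr s' a (int u * int k + int v) = g u v"
    and x: "var s' x = int i" and ag: "agree (For x z ?row) s s'" and ws: "word_state w s'"
  have z: "var s' z = int k" using ag assms by (simp add: agree_def)
  show "halts_within w ?row s' (real (wcost e + 13) * real k + 5)
      (\<lambda>s'. \<forall>u<Suc i. \<forall>v<k. arr s' a (int u * int k + int v) = g u v)"
  proof (rule halts_within_For_const[where k = k and K = "real (wcost e + 6)"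
      and I = "\<lambda>j s'. (\<forall>u<i. \<forall>v<k. arr s' a (int u * int k + int v) = g u v) \<and>
        (\<forall>v<j. arr s' a (int i * int k + int v) = g i v)"])
    fix j s2
    assume j: "j < k" and y: "var s2 y = int j" and ag2: "agree ?row s' s2"
      and I2: "(\<forall>u<i. \<forall>v<k. arr s2 a (int u * int k + int v) = g u v) \<and>
        (\<forall>v<j. arr s2 a (int i * int k + int v) = g i v)"
    have s2: "var s2 x = int i" "var s2 z = int k"
      using ag2 x z assms by (auto simp: agree_def)
    have "agree (fill x y z a e) s s2"
      using ag ag2 by (auto simp: agree_def fill_def)
    then have e2: "wok w e s2" "wval e s2 = g i j" using e[OF i j s2(1) y] by auto
    have wd: "is_word w (int i)" "is_word w (int j)" "is_word w (int k)"
      "is_word w (int i * int k)" "is_word w (int i * int k + int j)"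
      using i j assms(4) by (auto intro: is_word_nat is_word_index)
    show "halts_within w (Store a (Bin Add (Bin Mul (Var x) (Var z)) (Var y)) e) s2 (real (wcost e + 6))
        (\<lambda>s'. (\<forall>u<i. \<forall>v<k. arr s' a (int u * int k + int v) = g u v) \<and>
        (\<forall>v<Suc j. arr s' a (int i * int k + int v) = g i v))"
      using wd e2 I2 s2 y j by (auto simp: halts_within_wp wp_simps index_inj less_Suc_eq)
  qed (use assms i I ws z in \<open>auto simp: less_Suc_eq algebra_simps\<close>)
next
  have "real k \<le> (real k)\<^sup>2" "1 \<le> (real k)\<^sup>2"
    using assms(3) by (auto simp: power2_eq_square intro: mult_ge1_I)
  then show "real k * (real (wcost e + 13) * real k + 5) + 7 * real k + 5
      \<le> real (wcost e + 40) * (real k)\<^sup>2"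
    by (simp add: power2_eq_square algebra_simps)
qed (use assms in auto)

definition bounds_step :: prog where
  "bounds_step = Seq
    (Cond (WtLess (WtArr b (Var (b + 2))) (WtArr b (Var (b + 1)))) (Assign (b + 3) (Bin Add (Var (b + 3)) (Lit 1))) Skip)
    (Cond (Neg (WtLess (WtArr b (Var (b + 1))) (WtArr b (Var (b + 2))))) (Assign (b + 4) (Bin Add (Var (b + 4)) (Lit 1))) Skip)"

definition bounds_prog :: prog where
  "bounds_prog = For (b + 1) b (Seq (Seq (Assign (b + 3) (Lit 0)) (Assign (b + 4) (Lit 0)))
     (Seq (For (b + 2) b bounds_step)
     (Seq (Store (b + 2) (Var (b + 1)) (Var (b + 3))) (Store (b + 3) (Var (b + 1)) (Var (b + 4))))))"

lemma bounds_loop: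
  assumes "word_state w s" "var s b = int n" "\<forall>v<n. warr s b (int v) = W v"
    "var s (b + 1) = int x" "x < n" "var s (b + 3) = 0" "var s (b + 4) = 0"
  shows "halts_within w (For (b + 2) b bounds_step) s (30 * real n + 5)
    (\<lambda>s'. var s' (b + 3) = int (card {u. u < n \<and> W u < W x}) \<and>
          var s' (b + 4) = int (card {u. u < n \<and> W u \<le> W x}))"
proof (rule halts_within_For_const[where K = 23 and k = n
    and I = "\<lambda>i s'. var s' (b + 3) = int (card {u. u < i \<and> W u < W x}) \<and>
          var s' (b + 4) = int (card {u. u < i \<and> W u \<le> W x})"])
  fix i s'
  assume i: "i < n"
    and I: "var s' (b + 3) = int (card {u. u < i \<and> W u < W x}) \<and>
          var s' (b + 4) = int (card {u. u < i \<and> W u \<le> W x})"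
    and y: "var s' (b + 2) = int i" and ag: "agree (For (b + 2) b bounds_step) s s'"
  have s': "var s' (b + 1) = int x" "warr s' b = warr s b"
    using ag assms by (auto simp: agree_def bounds_step_def)
  have "is_word w (int (card {u. u < i \<and> P u}))" "is_word w (int (card {u. u < i \<and> P u}) + 1)" for P
    using card_less_le[of i P] i square_bound by (auto intro!: is_wordI)
  note wd = this[of "\<lambda>u. W u < W x"] this[of "\<lambda>u. W u \<le> W x"]
  show "halts_within w bounds_step s' 23 (\<lambda>s'. var s' (b + 3) = int (card {u. u < Suc i \<and> W u < W x}) \<and>
          var s' (b + 4) = int (card {u. u < Suc i \<and> W u \<le> W x}))"
    unfolding halts_within_wp bounds_step_def card_less_Suc
    using i I y s' wd assms by (auto simp: wp_simps is_word_nat)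
qed (use assms in \<open>auto simp: bounds_step_def\<close>)

lemma bounds_prog:
  assumes "word_state w s" "var s b = int n" "\<forall>v<n. warr s b (int v) = W v"
  shows "halts_within w bounds_prog s (70 * (real n)\<^sup>2)
    (\<lambda>s'. \<forall>v<n. arr s' (b + 2) (int v) = int (card {u. u < n \<and> W u < W v}) \<and>
                arr s' (b + 3) (int v) = int (card {u. u < n \<and> W u \<le> W v}))"
  unfolding bounds_prog_def
proof (rule halts_within_For_const[where K = "30 * real n + 20" and k = n
    and I = "\<lambda>i s'. \<forall>v<i. arr s' (b + 2) (int v) = int (card {u. u < n \<and> W u < W v}) \<and>
                arr s' (b + 3) (int v) = int (card {u. u < n \<and> W u \<le> W v})"])
  let ?I = "\<lambda>i s'. \<forall>v<i. arr s' (b + 2) (int v) = int (card {u. u < n \<and> W u < W v}) \<and>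
                arr s' (b + 3) (int v) = int (card {u. u < n \<and> W u \<le> W v})"
  let ?A = "Seq (Assign (b + 3) (Lit 0)) (Assign (b + 4) (Lit 0))"
  let ?C = "Seq (Store (b + 2) (Var (b + 1)) (Var (b + 3))) (Store (b + 3) (Var (b + 1)) (Var (b + 4)))"
  let ?body = "Seq ?A (Seq (For (b + 2) b bounds_step) ?C)"
  fix i s'
  assume i: "i < n" and I: "?I i s'" and x: "var s' (b + 1) = int i"
    and ag: "agree (For (b + 1) b ?body) s s'" and ws: "word_state w s'"
  have s': "var s' b = int n" "warr s' = warr s"
    using ag assms b_ge by (auto simp: agree_def bounds_step_def)
  show "halts_within w ?body s' (30 * real n + 20) (?I (Suc i))"
  proof (rule halts_within_Seq[where Q = "\<lambda>s'. var s' (b + 3) = 0 \<and> var s' (b + 4) = 0" and ?T1.0 = 4])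
    fix s1 assume s1: "var s1 (b + 3) = 0 \<and> var s1 (b + 4) = 0" and ag1: "agree ?A s' s1" and ws1: "word_state w s1"
    have s1': "var s1 b = int n" "var s1 (b + 1) = int i" "warr s1 = warr s" "arr s1 = arr s'"
      using ag1 s' x by (auto simp: agree_def)
    show "halts_within w (Seq (For (b + 2) b bounds_step) ?C) s1 (30 * real n + 16) (?I (Suc i))"
    proof (rule halts_within_Seq[OF bounds_loop[where W = W and x = i], where ?T2.0 = 11])
      fix s2 assume r: "var s2 (b + 3) = int (card {u. u < n \<and> W u < W i}) \<and>
          var s2 (b + 4) = int (card {u. u < n \<and> W u \<le> W i})"
        and ag2: "agree (For (b + 2) b bounds_step) s1 s2"
      have s2: "var s2 (b + 1) = int i" "arr s2 = arr s'"
        using ag2 s1' by (auto simp: agree_def bounds_step_def)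
      have wd: "is_word w (int (card {u. u < n \<and> P u}))" "is_word w (int i)" for P
        using card_less_le[of n P] i by (auto intro!: is_word_nat)
      show "halts_within w ?C s2 11 (?I (Suc i))"
        using i I s2 r wd by (auto simp: halts_within_wp wp_simps less_Suc_eq)
    qed (use s1 s1' ws1 i assms in auto)
  qed (auto simp: halts_within_wp wp_simps ws)
next
  show "real n * (30 * real n + 20) + 7 * real n + 5 \<le> 70 * (real n)\<^sup>2"
    using square_real by (simp add: power2_eq_square algebra_simps)
qed (use assms in \<open>auto simp: bounds_step_def\<close>)

end


section \<open>Two pointers: locating the completing class for every pair\<close>

context ram
begin

text \<open>For weights \<open>W\<close> in increasing order this is the first \<open>z\<close> with \<open>W z + (W x + W y) \<ge> 0\<close>, or \<open>n\<close>.\<close>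

definition first :: "(nat \<Rightarrow> int) \<Rightarrow> nat \<Rightarrow> nat \<Rightarrow> nat" where
  "first W x y = card {z. z < n \<and> W z + (W x + W y) < 0}"

lemma first_le: "first W x y \<le> n"
  unfolding first_def by (rule card_less_le)

lemma less_first_iff:
  assumes "\<And>i j. i \<le> j \<Longrightarrow> j < n \<Longrightarrow> W i \<le> W j" "z < n"
  shows "z < first W x y \<longleftrightarrow> W z + (W x + W y) < 0"
  unfolding first_def by (rule card_less_downward_closed) (use assms in fastforce)+

text \<open>A larger \<open>W y\<close> leaves fewer positions with negative sum. Along a row the
  pointer therefore only moves to the left, which keeps the row linear.\<close>

lemma first_antimono:
  assumes "\<And>i j. i \<le> j \<Longrightarrow> j < n \<Longrightarrow> W i \<le> W j" "y \<le> y'" "y' < n"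
  shows "first W x y' \<le> first W x y"
  unfolding first_def by (rule card_mono) (use assms(1)[OF assms(2,3)] in auto)

text \<open>\<open>Conj\<close> evaluates both arguments, so the weight array is also read at index \<open>- 1\<close>.\<close>

definition ptr_step :: prog where
  "ptr_step = Cond (Conj (Less (Lit 0) (Var (b + 3)))
      (Neg (WtLess (WtAdd (WtArr b (Bin Sub (Var (b + 3)) (Lit 1)))
        (WtAdd (WtArr b (Var (b + 1))) (WtArr b (Var (b + 2))))) WtZero)))
    (Assign (b + 3) (Bin Sub (Var (b + 3)) (Lit 1)))
    (Seq (Store (b + 4) (Bin Add (Bin Mul (Var (b + 1)) (Var b)) (Var (b + 2))) (Var (b + 3)))
      (Assign (b + 2) (Bin Add (Var (b + 2)) (Lit 1))))"

definition ptr_row :: prog where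
  "ptr_row = Seq (Seq (Assign (b + 2) (Lit 0)) (Assign (b + 3) (Var b)))
     (While (Less (Var (b + 2)) (Var b)) ptr_step)"

lemma ptr_row:
  assumes "word_state w s" "var s b = int n" "\<forall>v<n. warr s b (int v) = W v"
    and mono: "\<And>i j. i \<le> j \<Longrightarrow> j < n \<Longrightarrow> W i \<le> W j"
    and x: "var s (b + 1) = int x" "x < n"
    and rows: "\<forall>u<x. \<forall>v<n. arr s (b + 4) (int u * int n + int v) = int (first W u v)"
  shows "halts_within w ptr_row s (66 * real n + 20)
    (\<lambda>s'. \<forall>u<Suc x. \<forall>v<n. arr s' (b + 4) (int u * int n + int v) = int (first W u v))"
  unfolding ptr_row_def
proof (rule halts_within_Seq[where ?T1.0 = 4 and Q = "\<lambda>s'. var s' (b + 2) = 0 \<and> var s' (b + 3) = int n"])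
  show "halts_within w (Seq (Assign (b + 2) (Lit 0)) (Assign (b + 3) (Var b))) s 4
    (\<lambda>s'. var s' (b + 2) = 0 \<and> var s' (b + 3) = int n)"
    using assms by (simp add: halts_within_wp wp_simps)
next
  let ?loop = "While (Less (Var (b + 2)) (Var b)) ptr_step"
  \<comment> \<open>The bound on \<open>first\<close> is guarded by \<open>y < n\<close>: past the
    end of the row \<open>W y\<close> is not the weight of a vertex, and
    \<open>first_antimono\<close> says nothing about it.\<close>
  let ?J = "\<lambda>y c s'. var s' (b + 2) = int y \<and> var s' (b + 3) = int c \<and> y \<le> n \<and> c \<le> n \<and>
    (y < n \<longrightarrow> first W x y \<le> c) \<and>
    (\<forall>u<x. \<forall>v<n. arr s' (b + 4) (int u * int n + int v) = int (first W u v)) \<and>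
    (\<forall>v<y. arr s' (b + 4) (int x * int n + int v) = int (first W x v))"
  let ?I = "\<lambda>s'. \<exists>y c. ?J y c s'"
  \<comment> \<open>Every step lowers the pointer or advances the column. The measure starts at
    \<open>2 * n\<close>, and each step costs at most 30 plus 3 for the loop test, hence the
    \<open>66 * real n\<close>.\<close>
  let ?m = "\<lambda>s'. nat (int n - var s' (b + 2) + var s' (b + 3))"
  fix s1
  assume s1: "var s1 (b + 2) = 0 \<and> var s1 (b + 3) = int n" and ws1: "word_state w s1"
    and ag: "agree (Seq (Assign (b + 2) (Lit 0)) (Assign (b + 3) (Var b))) s s1"
  have s1': "var s1 b = int n" "var s1 (b + 1) = int x" "warr s1 = warr s" "arr s1 = arr s"
    using ag assms by (auto simp: agree_def)
  have I1: "?I s1"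
    using s1 s1' rows first_le[of W x 0] by (intro exI[of _ "0::nat"] exI[of _ n]) auto
  have "halts_within w ?loop s1 (real (?m s1) * (30 + real (tcost (Less (Var (b + 2)) (Var b)))) +
      real (tcost (Less (Var (b + 2)) (Var b)))) (\<lambda>s'. ?I s' \<and> \<not> tval (Less (Var (b + 2)) (Var b)) s')"
  proof (rule halts_within_While_measure[where I = ?I and m = ?m, OF ws1 I1])
    fix s2 assume "?I s2" and ag2: "agree ptr_step s1 s2"
    then obtain y where "var s2 (b + 2) = int y" "y \<le> n" by blast
    moreover have "var s2 b = int n" using ag2 s1' by (simp add: agree_def ptr_step_def)
    ultimately show "tok w (Less (Var (b + 2)) (Var b)) s2" by (simp add: is_word_nat)
  next
    fix s2 assume "?I s2" and ag2: "agree ptr_step s1 s2" and ws2: "word_state w s2" and "tval (Less (Var (b + 2)) (Var b)) s2"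
    have s2: "var s2 b = int n" "var s2 (b + 1) = int x" "warr s2 = warr s"
      using ag2 s1' by (auto simp: agree_def ptr_step_def)
    from \<open>?I s2\<close> obtain y c where yc: "var s2 (b + 2) = int y" "var s2 (b + 3) = int c"
      "c \<le> n" "y < n \<longrightarrow> first W x y \<le> c"
      and rows2: "\<forall>u<x. \<forall>v<n. arr s2 (b + 4) (int u * int n + int v) = int (first W u v)"
      and row2: "\<forall>v<y. arr s2 (b + 4) (int x * int n + int v) = int (first W x v)"
      by blast
    have "y < n" using \<open>tval _ s2\<close> s2 yc by simp
    have wd: "is_word w (int y)" "is_word w (int y + 1)" "is_word w (int c)" "is_word w (int c - 1)"
      "is_word w (int x)" "is_word w (int x * int n)" "is_word w (int x * int n + int y)"
      using \<open>y < n\<close> \<open>x < n\<close> yc square_bound by (auto intro: is_word_nat is_word_index is_wordI)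
    show "halts_within w ptr_step s2 30 (\<lambda>s3. ?I s3 \<and> ?m s3 < ?m s2)"
    proof (cases "0 < c \<and> \<not> W (c - 1) + (W x + W y) < 0")
      case True
      then obtain c' where c': "c = Suc c'" by (cases c) auto
      have "c' < n" using c' yc by simp
      have "first W x y \<le> c'"
        using less_first_iff[of W c' x y, OF mono \<open>c' < n\<close>] True c' by auto
      moreover have "wtval (WtArr b (Bin Sub (Var (b + 3)) (Lit 1))) s2 = W c'"
        using yc c' s2 assms(3) \<open>c' < n\<close> by simp
      ultimately have "halts_within w ptr_step s2 30 (?J y c')"
        using yc True c' s2 wd rows2 row2 \<open>y < n\<close> \<open>x < n\<close> assms(3)
        unfolding halts_within_wp ptr_step_def
        by (auto simp: wp_simps)
      then show ?thesis
      proof (rule halts_within_mono)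
        fix s3 assume *: "?J y c' s3"
        then have "?m s3 < ?m s2" using yc c' by simp
        with * show "?I s3 \<and> ?m s3 < ?m s2" by blast
      qed simp
    next
      case False
      \<comment> \<open>The invariant gives \<open>first W x y \<le> c\<close>. Conversely, either
        \<open>c = 0\<close>, or the failed test puts position \<open>c - 1\<close> among those with
        negative sum.\<close>
      have c: "first W x y = c"
      proof (cases c)
        case 0
        then show ?thesis using yc \<open>y < n\<close> by simp
      next
        case (Suc c')
        then have "c' < first W x y"
          using False yc less_first_iff[of W c' x y, OF mono] by simp
        then show ?thesis using Suc yc \<open>y < n\<close> by simp
      qed
      \<comment> \<open>For \<open>c = 0\<close> the weight read at index \<open>- 1\<close> is
        arbitrary, but the first conjunct is already false.\<close>
      have "\<not> (0 < c \<and> \<not> warr s2 b (int c - 1) + (W x + W y) < 0)"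
        using False yc s2 assms(3) by (cases c) auto
      moreover have "Suc y < n \<longrightarrow> first W x (Suc y) \<le> c"
        using first_antimono[of W y "Suc y" x, OF mono] c by auto
      ultimately have "halts_within w ptr_step s2 30 (?J (Suc y) c)"
        using yc s2 wd rows2 row2 \<open>y < n\<close> \<open>x < n\<close> assms(3) c
        unfolding halts_within_wp ptr_step_def
        by (auto simp: wp_simps index_inj less_Suc_eq)
      then show ?thesis
      proof (rule halts_within_mono)
        fix s3 assume *: "?J (Suc y) c s3"
        then have "?m s3 < ?m s2" using yc \<open>y < n\<close> by simp
        with * show "?I s3 \<and> ?m s3 < ?m s2" by blast
      qed simp
    qed
  qed simp
  then show "halts_within w ?loop s1 (66 * real n + 16)
    (\<lambda>s'. \<forall>u<Suc x. \<forall>v<n. arr s' (b + 4) (int u * int n + int v) = int (first W u v))"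
  proof (rule halts_within_frame[THEN halts_within_mono, OF _ ws1])
    show "real (?m s1) * (30 + real (tcost (Less (Var (b + 2)) (Var b)))) +
      real (tcost (Less (Var (b + 2)) (Var b))) \<le> 66 * real n + 16"
      using s1 by (simp add: nat_mult_distrib)
  next
    fix s2
    assume *: "(?I s2 \<and> \<not> tval (Less (Var (b + 2)) (Var b)) s2) \<and> agree ?loop s1 s2 \<and> word_state w s2"
    then have "var s2 b = int n" using s1' by (auto simp: agree_def ptr_step_def)
    with * show "\<forall>u<Suc x. \<forall>v<n. arr s2 (b + 4) (int u * int n + int v) = int (first W u v)"
      by (auto simp: less_Suc_eq)
  qed
qed (use assms in auto)

definition ptr_prog :: prog where
  "ptr_prog = For (b + 1) b ptr_row"

lemma ptr_prog:
  assumes "word_state w s" "var s b = int n" "\<forall>v<n. warr s b (int v) = W v"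
    and mono: "\<And>i j. i \<le> j \<Longrightarrow> j < n \<Longrightarrow> W i \<le> W j"
  shows "halts_within w ptr_prog s (100 * (real n)\<^sup>2)
    (\<lambda>s'. \<forall>u<n. \<forall>v<n. arr s' (b + 4) (int u * int n + int v) = int (first W u v))"
  unfolding ptr_prog_def
proof (rule halts_within_For_const[where K = "66 * real n + 20" and k = n
    and I = "\<lambda>i s'. \<forall>u<i. \<forall>v<n. arr s' (b + 4) (int u * int n + int v) = int (first W u v)"])
  fix i s'
  assume i: "i < n" and I: "\<forall>u<i. \<forall>v<n. arr s' (b + 4) (int u * int n + int v) = int (first W u v)"
    and x: "var s' (b + 1) = int i" and ag: "agree (For (b + 1) b ptr_row) s s'" and ws: "word_state w s'"
  have "var s' b = int n" "warr s' b = warr s b"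
    using ag assms by (auto simp: agree_def ptr_row_def ptr_step_def)
  then show "halts_within w ptr_row s' (66 * real n + 20)
    (\<lambda>s'. \<forall>u<Suc i. \<forall>v<n. arr s' (b + 4) (int u * int n + int v) = int (first W u v))"
    using ws x i assms(3) I by (intro ptr_row mono) auto
next
  show "real n * (66 * real n + 20) + 7 * real n + 5 \<le> 100 * (real n)\<^sup>2"
    using square_real by (simp add: power2_eq_square algebra_simps)
qed (use assms in \<open>auto simp: ptr_row_def ptr_step_def\<close>)

end


section \<open>Searching the blocks\<close>

locale ram_mult = ram +
  fixes P :: prog and f :: real
  \<comment> \<open>\<open>f\<close> stands for \<open>MM n n n / n\<^sup>2\<close>\<close>
  assumes writes_low: "x \<in> wr_var P \<union> wr_arr P \<union> wr_warr P \<Longrightarrow> x < b"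
    and f_ge: "1 \<le> f"
    and mult: "1 \<le> m \<Longrightarrow> m \<le> n \<Longrightarrow> word_state w s \<Longrightarrow>
      var s 0 = int m \<Longrightarrow> var s 1 = int m \<Longrightarrow> var s 2 = int m \<Longrightarrow>
      \<forall>i<m. \<forall>j<m. arr s 0 (int i * int m + int j) = of_bool (\<alpha> i j) \<Longrightarrow>
      \<forall>i<m. \<forall>j<m. arr s 1 (int i * int m + int j) = of_bool (\<beta> i j) \<Longrightarrow>
      halts_within w P s (f * (real m)\<^sup>2) (\<lambda>s'. \<forall>i<m. \<forall>j<m.
        arr s' 2 (int i * int m + int j) \<noteq> 0 \<longleftrightarrow> (\<exists>l<m. \<alpha> i l \<and> \<beta> l j))"
begin

lemma not_written: "b \<le> x \<Longrightarrow> x \<notin> wr_var P \<and> x \<notin> wr_arr P \<and> x \<notin> wr_warr P"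
  using writes_low[of x] by auto

text \<open>A cell of the sorted adjacency matrix relative to a block corner held in registers
  \<open>u\<close> and \<open>v\<close>; it serves both factors and the final check.\<close>

definition entry :: "nat \<Rightarrow> nat \<Rightarrow> wexp" where
  "entry u v = Arr b (Bin Add (Bin Mul (Bin Add (Var u) (Var (b + 7))) (Var b)) (Bin Add (Var v) (Var (b + 8))))"

definition check_cell :: prog where
  "check_cell = Cond (Conj (Neg (Eq (Arr 2 (Bin Add (Bin Mul (Var (b + 7)) (Var (b + 4))) (Var (b + 8)))) (Lit 0)))
      (Eq (entry (b + 5) (b + 6)) (Lit 1)))
    (Assign (b + 9) (Lit 1)) Skip"

definition check :: prog where
  "check = For (b + 7) (b + 4) (For (b + 8) (b + 4) check_cell)"

text \<open>Repeated before every call, since the multiplication program may overwrite its own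
  arguments.\<close>

definition set_dims :: prog where
  "set_dims = Seq (Assign 0 (Var (b + 4))) (Seq (Assign 1 (Var (b + 4))) (Assign 2 (Var (b + 4))))"

definition block :: prog where
  "block = Seq (fill (b + 7) (b + 8) (b + 4) 0 (entry (b + 5) (b + 3)))
    (Seq (fill (b + 7) (b + 8) (b + 4) 1 (entry (b + 3) (b + 6)))
    (Seq set_dims (Seq P check)))"

definition block_regs :: "(nat \<Rightarrow> nat \<Rightarrow> bool) \<Rightarrow> nat \<Rightarrow> nat \<Rightarrow> nat \<Rightarrow> nat \<Rightarrow> state \<Rightarrow> bool" where
  "block_regs A c m x y s \<longleftrightarrow> var s b = int n \<and> var s (b + 3) = int c \<and> var s (b + 4) = int m \<and>
     var s (b + 5) = int x \<and> var s (b + 6) = int y \<and>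
     (\<forall>i<n. \<forall>j<n. arr s b (int i * int n + int j) = of_bool (A i j))"

lemma entry:
  assumes "var s b = int n" "\<forall>i<n. \<forall>j<n. arr s b (int i * int n + int j) = of_bool (A i j)"
    and "var s u = int i" "var s v = int j" "var s (b + 7) = int p" "var s (b + 8) = int q"
    and "i + p < n" "j + q < n"
  shows "wok w (entry u v) s \<and> wval (entry u v) s = of_bool (A (i + p) (j + q))"
proof -
  have "arr s b (int (i + p) * int n + int (j + q)) = of_bool (A (i + p) (j + q))"
    using assms by blast
  moreover have "is_word w (int (i + p) * int n + int (j + q))" "is_word w (int (i + p) * int n)"
    using assms by (auto simp del: of_nat_add intro!: is_word_index)
  moreover have "is_word w (int (i + p))" "is_word w (int (j + q))" "is_word w (int i)" "is_word w (int j)"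
    "is_word w (int p)" "is_word w (int q)"
    using assms(7,8) by (auto simp del: of_nat_add intro!: is_word_nat)
  ultimately show ?thesis
    using assms(1,3-6) by (simp add: entry_def)
qed

lemma wcost_entry: "wcost (entry u v) = 10"
  by (simp add: entry_def)

lemma check:
  assumes "word_state w s" "block_regs A c m x y s" "1 \<le> m" "m \<le> n" "x + m \<le> n" "y + m \<le> n"
    and prod: "\<forall>i<m. \<forall>j<m. arr s 2 (int i * int m + int j) \<noteq> 0 \<longleftrightarrow> C i j"
    and ans: "var s (b + 9) = of_bool r"
  shows "halts_within w check s (70 * (real m)\<^sup>2)
    (\<lambda>s'. var s' (b + 9) = of_bool (r \<or> (\<exists>i<m. \<exists>j<m. C i j \<and> A (x + i) (y + j))))"
  unfolding check_def
proof (rule halts_within_For_const[where k = m and K = "40 * real m + 5"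
    and I = "\<lambda>i s'. var s' (b + 9) = of_bool (r \<or> (\<exists>u<i. \<exists>j<m. C u j \<and> A (x + u) (y + j)))"])
  let ?row = "For (b + 8) (b + 4) check_cell"
  fix i s'
  assume i: "i < m" and I: "var s' (b + 9) = of_bool (r \<or> (\<exists>u<i. \<exists>j<m. C u j \<and> A (x + u) (y + j)))"
    and p: "var s' (b + 7) = int i" and ag: "agree (For (b + 7) (b + 4) ?row) s s'" and ws: "word_state w s'"
  have s': "block_regs A c m x y s'" "arr s' = arr s"
    using ag assms(2) by (auto simp: agree_def block_regs_def check_cell_def)
  show "halts_within w ?row s' (40 * real m + 5)
      (\<lambda>s'. var s' (b + 9) = of_bool (r \<or> (\<exists>u<Suc i. \<exists>j<m. C u j \<and> A (x + u) (y + j))))"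
  proof (rule halts_within_For_const[where k = m and K = 30
      and I = "\<lambda>j s'. var s' (b + 9) = of_bool (r \<or> (\<exists>u<i. \<exists>j<m. C u j \<and> A (x + u) (y + j)) \<or>
        (\<exists>v<j. C i v \<and> A (x + i) (y + v)))"])
    fix j s2
    assume j: "j < m" and q: "var s2 (b + 8) = int j" and ag2: "agree (For (b + 8) (b + 4) check_cell) s' s2"
      and I2: "var s2 (b + 9) = of_bool (r \<or> (\<exists>u<i. \<exists>j<m. C u j \<and> A (x + u) (y + j)) \<or>
        (\<exists>v<j. C i v \<and> A (x + i) (y + v)))" and ws2: "word_state w s2"
    have s2: "block_regs A c m x y s2" "arr s2 = arr s" "var s2 (b + 7) = int i"
      using ag2 s' p by (auto simp: agree_def block_regs_def check_cell_def)
    have e: "wok w (entry (b + 5) (b + 6)) s2 \<and> wval (entry (b + 5) (b + 6)) s2 = of_bool (A (x + i) (y + j))"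
      using s2 q i j assms(5,6)
      by (intro entry[where A = A and i = x and j = y and p = i and q = j]) (auto simp: block_regs_def)
    \<comment> \<open>About the product entries \<open>mult\<close> says only which are nonzero;
      that they can be read at all comes from \<open>word_state\<close>.\<close>
    have wd: "is_word w (int i)" "is_word w (int j)" "is_word w (int m)"
      "is_word w (int i * int m)" "is_word w (int i * int m + int j)" "is_word w (arr s2 2 z)" for z
      using i j assms(4) ws2 by (auto intro: is_word_nat is_word_index simp: word_state_def)
    have a2: "arr s 2 (int i * int m + int j) = 0 \<longleftrightarrow> \<not> C i j" using prod i j by blast
    have mn: "var s2 (b + 4) = int m" using s2 by (simp add: block_regs_def)
    define R where "R \<longleftrightarrow> r \<or> (\<exists>u<i. \<exists>j<m. C u j \<and> A (x + u) (y + j)) \<or> (\<exists>v<j. C i v \<and> A (x + i) (y + v))"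
    have R: "var s2 (b + 9) = of_bool R" unfolding R_def by (rule I2)
    have "(r \<or> (\<exists>u<i. \<exists>j<m. C u j \<and> A (x + u) (y + j)) \<or> (\<exists>v<Suc j. C i v \<and> A (x + i) (y + v))) \<longleftrightarrow>
        R \<or> C i j \<and> A (x + i) (y + j)"
      unfolding R_def Ex_less_Suc by blast
    moreover have "halts_within w check_cell s2 30 (\<lambda>s'. var s' (b + 9) = of_bool (R \<or> C i j \<and> A (x + i) (y + j)))"
      using s2(2,3) q e wd R a2 mn by (simp add: halts_within_wp check_cell_def wp_simps wcost_entry)
    ultimately show "halts_within w check_cell s2 30 (\<lambda>s'. var s' (b + 9) =
        of_bool (r \<or> (\<exists>u<i. \<exists>j<m. C u j \<and> A (x + u) (y + j)) \<or>
        (\<exists>v<Suc j. C i v \<and> A (x + i) (y + v))))"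
      by (simp only:)
  next
    fix s2 :: state assume *: "var s2 (b + 9) = of_bool (r \<or> (\<exists>u<i. \<exists>j<m. C u j \<and> A (x + u) (y + j)) \<or>
        (\<exists>v<m. C i v \<and> A (x + i) (y + v)))"
    have "(\<exists>u<Suc i. \<exists>j<m. C u j \<and> A (x + u) (y + j)) \<longleftrightarrow>
        (\<exists>u<i. \<exists>j<m. C u j \<and> A (x + u) (y + j)) \<or> (\<exists>v<m. C i v \<and> A (x + i) (y + v))"
      unfolding Ex_less_Suc by blast
    then show "var s2 (b + 9) = of_bool (r \<or> (\<exists>u<Suc i. \<exists>j<m. C u j \<and> A (x + u) (y + j)))"
      unfolding * by presburger
  qed (use I ws s' in \<open>simp_all add: check_cell_def block_regs_def algebra_simps\<close>)
next
  have "real m \<le> (real m)\<^sup>2" "1 \<le> (real m)\<^sup>2"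
    using assms(3) by (auto simp: power2_eq_square intro: mult_ge1_I)
  then show "real m * (40 * real m + 5) + 7 * real m + 5 \<le> 70 * (real m)\<^sup>2"
    by (simp add: power2_eq_square algebra_simps)
qed (use assms in \<open>simp_all add: check_cell_def block_regs_def\<close>)

text \<open>The factors hold the edges from the \<open>x\<close> block to the third class and from
  there to the \<open>y\<close> block. A nonzero entry is thus a common neighbour in the third
  class, and \<open>check\<close> adds the closing edge. Apart from the call the cost is at most
  \<open>176 * m\<^sup>2\<close>, which \<open>1 \<le> f\<close> merges into the bound.\<close>

lemma block:
  assumes ws: "word_state w s" and regs: "block_regs A c m x y s" and m: "1 \<le> m" "m \<le> n"
    and le: "c + m \<le> n" "x + m \<le> n" "y + m \<le> n" and ans: "var s (b + 9) = of_bool r"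
  shows "halts_within w block s (200 * f * (real m)\<^sup>2)
    (\<lambda>s'. var s' (b + 9) =
      of_bool (r \<or> (\<exists>i<m. \<exists>j<m. (\<exists>l<m. A (x + i) (c + l) \<and> A (c + l) (y + j)) \<and> A (x + i) (y + j))))"
proof -
  let ?Q = "\<lambda>s'. var s' (b + 9) =
      of_bool (r \<or> (\<exists>i<m. \<exists>j<m. (\<exists>l<m. A (x + i) (c + l) \<and> A (c + l) (y + j)) \<and> A (x + i) (y + j)))"
  let ?F = "\<lambda>s. block_regs A c m x y s \<and> word_state w s \<and> var s (b + 9) = of_bool r"
  let ?S = "\<lambda>a g s. \<forall>i<m. \<forall>j<m. arr s a (int i * int m + int j) = of_bool (g i j)"
  let ?\<alpha> = "\<lambda>i j. A (x + i) (c + j)" and ?\<beta> = "\<lambda>i j. A (c + i) (y + j)"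
  have b3: "b \<noteq> 0" "b \<noteq> 1" "b \<noteq> 2" "b \<noteq> Suc 0" "\<And>i. b + i \<noteq> 0" "\<And>i. b + i \<noteq> 1" "\<And>i. b + i \<noteq> 2" using b_ge by auto
  have mm: "1 \<le> (real m)\<^sup>2" using m by (auto simp: power2_eq_square intro: mult_ge1_I)
  have "halts_within w block s (50 * (real m)\<^sup>2 + (50 * (real m)\<^sup>2 + (6 + (f * (real m)\<^sup>2 + 70 * (real m)\<^sup>2)))) ?Q"
    unfolding block_def
  proof (rule halts_within_Seq[OF _ ws _ order.refl])
    show "halts_within w (fill (b + 7) (b + 8) (b + 4) 0 (entry (b + 5) (b + 3))) s (50 * (real m)\<^sup>2) (?S 0 ?\<alpha>)"
    proof (rule halts_within_mono[OF fill[where k = m and g = "\<lambda>i j. of_bool (?\<alpha> i j)"]])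
      fix i j s' assume "i < m" "j < m" "var s' (b + 7) = int i" "var s' (b + 8) = int j"
        "agree (fill (b + 7) (b + 8) (b + 4) 0 (entry (b + 5) (b + 3))) s s'"
      then show "wok w (entry (b + 5) (b + 3)) s' \<and> wval (entry (b + 5) (b + 3)) s' = of_bool (?\<alpha> i j)"
        using regs le b3
          by (intro entry[where A = A and i = x and j = c and p = i and q = j]) (auto simp: block_regs_def agree_def)
    qed (use ws regs m in \<open>auto simp: wcost_entry block_regs_def\<close>)
    fix s1 assume 1: "?S 0 ?\<alpha> s1" "agree (fill (b + 7) (b + 8) (b + 4) 0 (entry (b + 5) (b + 3))) s s1" "word_state w s1"
    then have F1: "?F s1" using regs ans b3 by (auto simp: block_regs_def agree_def)
    show "halts_within w (Seq (fill (b + 7) (b + 8) (b + 4) 1 (entry (b + 3) (b + 6))) (Seq set_dims (Seq P check))) s1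
      (50 * (real m)\<^sup>2 + (6 + (f * (real m)\<^sup>2 + 70 * (real m)\<^sup>2))) ?Q"
    proof (rule halts_within_Seq[OF _ 1(3) _ order.refl])
      show "halts_within w (fill (b + 7) (b + 8) (b + 4) 1 (entry (b + 3) (b + 6))) s1 (50 * (real m)\<^sup>2) (?S 1 ?\<beta>)"
      proof (rule halts_within_mono[OF fill[where k = m and g = "\<lambda>i j. of_bool (?\<beta> i j)"]])
        fix i j s' assume "i < m" "j < m" "var s' (b + 7) = int i" "var s' (b + 8) = int j"
          "agree (fill (b + 7) (b + 8) (b + 4) 1 (entry (b + 3) (b + 6))) s1 s'"
        then show "wok w (entry (b + 3) (b + 6)) s' \<and> wval (entry (b + 3) (b + 6)) s' = of_bool (?\<beta> i j)"
          using conjunct1[OF F1] le b3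
            by (intro entry[where A = A and i = c and j = y and p = i and q = j]) (auto simp: block_regs_def agree_def)
      qed (use conjunct1[OF F1] 1(3) m in \<open>auto simp: wcost_entry block_regs_def\<close>)
      fix s2 assume 2: "?S 1 ?\<beta> s2" "agree (fill (b + 7) (b + 8) (b + 4) 1 (entry (b + 3) (b + 6))) s1 s2" "word_state w s2"
      then have F2: "?F s2" and S2: "?S 0 ?\<alpha> s2" using F1 1(1) b3 by (auto simp: block_regs_def agree_def)
      show "halts_within w (Seq set_dims (Seq P check)) s2 (6 + (f * (real m)\<^sup>2 + 70 * (real m)\<^sup>2)) ?Q"
      proof (rule halts_within_Seq[OF _ 2(3) _ order.refl])
        have "is_word w (int m)" using m by (auto intro: is_word_nat)
        then show "halts_within w set_dims s2 6 (\<lambda>s3. var s3 0 = int m \<and> var s3 1 = int m \<and> var s3 2 = int m)"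
          using F2 b3 by (simp add: set_dims_def halts_within_wp wp_simps block_regs_def)
        fix s3 assume 3: "var s3 0 = int m \<and> var s3 1 = int m \<and> var s3 2 = int m" "agree set_dims s2 s3" "word_state w s3"
        then have F3: "?F s3" and S3: "?S 0 ?\<alpha> s3" "?S 1 ?\<beta> s3"
          using F2 S2 2(1) b3 by (auto simp: block_regs_def agree_def set_dims_def)
        show "halts_within w (Seq P check) s3 (f * (real m)\<^sup>2 + 70 * (real m)\<^sup>2) ?Q"
        proof (rule halts_within_Seq[OF mult[of m s3 ?\<alpha> ?\<beta>] 3(3) _ order.refl])
          fix s4 assume 4: "\<forall>i<m. \<forall>j<m. (arr s4 2 (int i * int m + int j) \<noteq> 0) =
              (\<exists>l<m. A (x + i) (c + l) \<and> A (c + l) (y + j))" "agree P s3 s4" "word_state w s4"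
          then have "?F s4" using F3 by (auto simp: block_regs_def agree_def not_written)
          then show "halts_within w check s4 (70 * (real m)\<^sup>2) ?Q"
            using check[of s4 A c m x y "\<lambda>i j. \<exists>l<m. A (x + i) (c + l) \<and> A (c + l) (y + j)" r] 4(1) m le by blast
        qed (use m 3 S3 in auto)
      qed
    qed
  qed
  then show ?thesis
  proof (rule halts_within_mono)
    have "(real m)\<^sup>2 \<le> f * (real m)\<^sup>2" using mult_right_mono[OF f_ge, of "(real m)\<^sup>2"] by simp
    then show "50 * (real m)\<^sup>2 + (50 * (real m)\<^sup>2 + (6 + (f * (real m)\<^sup>2 + 70 * (real m)\<^sup>2))) \<le> 200 * f * (real m)\<^sup>2"
      using mm by (simp add: algebra_simps)
  qed
qed

end


section \<open>Weight classes and their blocks\<close>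

context ram
begin

definition lo :: "(nat \<Rightarrow> int) \<Rightarrow> nat \<Rightarrow> nat" where
  "lo W v = card {u. u < n \<and> W u < W v}"

definition hi :: "(nat \<Rightarrow> int) \<Rightarrow> nat \<Rightarrow> nat" where
  "hi W v = card {u. u < n \<and> W u \<le> W v}"

text \<open>The size of the weight class that completes those of \<open>x\<close> and \<open>y\<close>, if there is one.\<close>

definition msize :: "(nat \<Rightarrow> int) \<Rightarrow> nat \<Rightarrow> nat \<Rightarrow> nat" where
  "msize W x y = hi W (first W x y) - first W x y"

text \<open>Marks the block starts, counted from the beginning of the class. The first conjunct is
  where the restriction to a smallest third class enters; it also leaves room for moving the last
  block back.\<close>

definition aligned :: "(nat \<Rightarrow> int) \<Rightarrow> nat \<Rightarrow> nat \<Rightarrow> bool" where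
  "aligned W m x \<longleftrightarrow> m \<le> hi W x - lo W x \<and> (x - lo W x) mod m = 0"

text \<open>A block pair is represented by its corner, so a plain double loop over all positions
  meets each pair of blocks exactly once. The equation is tested because \<open>first\<close> exists
  even when no class completes the sum.\<close>

definition relevant :: "(nat \<Rightarrow> int) \<Rightarrow> nat \<Rightarrow> nat \<Rightarrow> bool" where
  "relevant W x y \<longleftrightarrow> first W x y < n \<and> W (first W x y) + (W x + W y) = 0 \<and>
     aligned W (msize W x y) x \<and> aligned W (msize W x y) y"

text \<open>The last block of a class is moved back to end with the class, so that no padding is needed.\<close>

definition shift :: "(nat \<Rightarrow> int) \<Rightarrow> nat \<Rightarrow> nat \<Rightarrow> nat" where
  "shift W m x = (if hi W x < x + m then hi W x - m else x)"

definition block_triangle :: "(nat \<Rightarrow> nat \<Rightarrow> bool) \<Rightarrow> nat \<Rightarrow> nat \<Rightarrow> nat \<Rightarrow> nat \<Rightarrow> bool" where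
  "block_triangle A c m x y \<longleftrightarrow>
     (\<exists>i<m. \<exists>j<m. (\<exists>l<m. A (x + i) (c + l) \<and> A (c + l) (y + j)) \<and> A (x + i) (y + j))"

definition found :: "(nat \<Rightarrow> nat \<Rightarrow> bool) \<Rightarrow> (nat \<Rightarrow> int) \<Rightarrow> nat \<Rightarrow> nat \<Rightarrow> bool" where
  "found A W x y \<longleftrightarrow> relevant W x y \<and> block_triangle A (first W x y) (msize W x y)
     (shift W (msize W x y) x) (shift W (msize W x y) y)"

lemma hi_le: "hi W v \<le> n"
  unfolding hi_def by (rule card_less_le)

lemma less_lo_iff:
  assumes "\<And>i j. i \<le> j \<Longrightarrow> j < n \<Longrightarrow> W i \<le> W j" "u < n"
  shows "u < lo W v \<longleftrightarrow> W u < W v"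
  unfolding lo_def by (rule card_less_downward_closed) (use assms in fastforce)+

lemma less_hi_iff:
  assumes "\<And>i j. i \<le> j \<Longrightarrow> j < n \<Longrightarrow> W i \<le> W j" "u < n"
  shows "u < hi W v \<longleftrightarrow> W u \<le> W v"
  unfolding hi_def by (rule card_less_downward_closed) (use assms in fastforce)+

lemma class_iff:
  assumes "\<And>i j. i \<le> j \<Longrightarrow> j < n \<Longrightarrow> W i \<le> W j" "u < n"
  shows "W u = W v \<longleftrightarrow> lo W v \<le> u \<and> u < hi W v"
  using less_lo_iff[of W u v, OF assms] less_hi_iff[of W u v, OF assms] by force

lemma lo_hi_cong: "W u = W v \<Longrightarrow> lo W u = lo W v \<and> hi W u = hi W v"
  by (simp add: lo_def hi_def)

lemma lo_hi_self:
  assumes "\<And>i j. i \<le> j \<Longrightarrow> j < n \<Longrightarrow> W i \<le> W j" "v < n"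
  shows "lo W v \<le> v" "v < hi W v"
  using class_iff[of W v v, OF assms] by auto

lemma first_eq_lo:
  assumes "W c + (W x + W y) = 0"
  shows "first W x y = lo W c"
proof -
  have "W z + (W x + W y) < 0 \<longleftrightarrow> W z < W c" for z using assms by linarith
  then show ?thesis by (simp add: first_def lo_def)
qed

lemma msize_bounds:
  assumes mono: "\<And>i j. i \<le> j \<Longrightarrow> j < n \<Longrightarrow> W i \<le> W j" and "first W x y < n"
    and "W (first W x y) + (W x + W y) = 0"
  shows "1 \<le> msize W x y" "first W x y + msize W x y \<le> n"
    "first W x y + msize W x y = hi W (first W x y)"
  using lo_hi_self(2)[of W "first W x y", OF mono assms(2)] hi_le[of W "first W x y"]
  by (auto simp: msize_def)

lemma shift_bounds:
  assumes mono: "\<And>i j. i \<le> j \<Longrightarrow> j < n \<Longrightarrow> W i \<le> W j" and "x < n" and "aligned W m x"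
  shows "lo W x \<le> shift W m x" "shift W m x + m \<le> hi W x"
  using lo_hi_self[of W x, OF mono assms(2)] assms(3)
  by (auto simp: shift_def aligned_def)

end

section \<open>The program for one pair of positions\<close>

context ram_mult
begin

definition aligned_test :: "nat \<Rightarrow> test" where
  "aligned_test x = Conj (Neg (Less (Bin Sub (Arr (b + 3) (Var x)) (Arr (b + 2) (Var x))) (Var (b + 4))))
     (Eq (Bin Mod (Bin Sub (Var x) (Arr (b + 2) (Var x))) (Var (b + 4))) (Lit 0))"

definition shift_prog :: "nat \<Rightarrow> nat \<Rightarrow> prog" where
  "shift_prog x x' = Cond (Less (Arr (b + 3) (Var x)) (Bin Add (Var x) (Var (b + 4))))
     (Assign x' (Bin Sub (Arr (b + 3) (Var x)) (Var (b + 4)))) (Assign x' (Var x))"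

definition cell_prog :: prog where
  "cell_prog = Seq (Assign (b + 3) (Arr (b + 4) (Bin Add (Bin Mul (Var (b + 1)) (Var b)) (Var (b + 2)))))
    (Cond (Conj (Less (Var (b + 3)) (Var b))
        (WtEq (WtAdd (WtArr b (Var (b + 3))) (WtAdd (WtArr b (Var (b + 1))) (WtArr b (Var (b + 2))))) WtZero))
      (Seq (Assign (b + 4) (Bin Sub (Arr (b + 3) (Var (b + 3))) (Var (b + 3))))
        (Cond (Conj (aligned_test (b + 1)) (aligned_test (b + 2)))
          (Seq (Seq (shift_prog (b + 1) (b + 5)) (shift_prog (b + 2) (b + 6))) block) Skip))
      Skip)"

definition main_prog :: prog where
  "main_prog = Seq (Assign (b + 9) (Lit 0)) (Seq (For (b + 1) b (For (b + 2) b cell_prog)) (Assign 0 (Var (b + 9))))"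

definition tables :: "(nat \<Rightarrow> nat \<Rightarrow> bool) \<Rightarrow> (nat \<Rightarrow> int) \<Rightarrow> state \<Rightarrow> bool" where
  "tables A W s \<longleftrightarrow> var s b = int n \<and> (\<forall>i<n. \<forall>j<n. arr s b (int i * int n + int j) = of_bool (A i j)) \<and>
     (\<forall>v<n. warr s b (int v) = W v) \<and>
     (\<forall>v<n. arr s (b + 2) (int v) = int (lo W v)) \<and> (\<forall>v<n. arr s (b + 3) (int v) = int (hi W v)) \<and>
     (\<forall>i<n. \<forall>j<n. arr s (b + 4) (int i * int n + int j) = int (first W i j))"

lemma b_not_written [simp]: "b \<notin> wr_var P" "b + i \<notin> wr_var P" "b \<notin> wr_arr P" "b + i \<notin> wr_arr P"
    "b \<notin> wr_warr P" "Suc b \<notin> wr_var P" "Suc (Suc b) \<notin> wr_var P" "Suc (Suc b) \<notin> wr_arr P"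
  using not_written by auto

lemma wr_block:
  "wr_var block = {b + 7, b + 8, b + 9, 0, 1, 2} \<union> wr_var P" "wr_arr block = {0, 1} \<union> wr_arr P"
  "wr_warr block = wr_warr P"
  by (auto simp: block_def set_dims_def check_def check_cell_def)

lemma wr_cell:
  "wr_var cell_prog = {b + 3, b + 4, b + 5, b + 6} \<union> wr_var block" "wr_arr cell_prog = wr_arr block"
  "wr_warr cell_prog = wr_warr P"
  by (auto simp: cell_prog_def shift_prog_def wr_block)

lemma aligned_test:
  assumes T: "tables A W s" and mono: "\<And>i j. i \<le> j \<Longrightarrow> j < n \<Longrightarrow> W i \<le> W j"
    and r: "var s r = int x" "x < n" and m: "var s (b + 4) = int m" "1 \<le> m" "m \<le> n"
  shows "tok w (aligned_test r) s \<and> (tval (aligned_test r) s \<longleftrightarrow> aligned W m x)"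
proof -
  note b = lo_hi_self[of W x, OF mono r(2)] hi_le[of W x]
  \<comment> \<open>Naming the differences makes integer subtraction in the program and truncated
    subtraction in \<open>aligned\<close> coincide.\<close>
  obtain k where k: "hi W x = lo W x + k" using b by (metis le_Suc_ex less_imp_le_nat order.trans)
  obtain e where e: "x = lo W x + e" using b by (metis le_Suc_ex)
  have "e mod m \<le> n"
    using mod_less_divisor[of m e] m by linarith
  then have "is_word w (int (e mod m))" by (rule is_word_nat)
  then have "is_word w (int e mod int m)" by (simp add: zmod_int)
  moreover have "is_word w (int x)" "is_word w (int m)" "is_word w (int (lo W x))" "is_word w (int (hi W x))"
    "is_word w (int k)" "is_word w (int e)"
    by (rule is_word_nat; use b r(2) k e m in linarith)+
  moreover have "int (hi W x) - int (lo W x) = int k" "int x - int (lo W x) = int e"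
    "hi W x - lo W x = k" "x - lo W x = e"
    using k e by linarith+
  moreover have "int e mod int m = 0 \<longleftrightarrow> e mod m = 0" by (metis of_nat_eq_0_iff zmod_int)
  moreover have "arr s (b + 2) (int x) = int (lo W x)" "arr s (b + 3) (int x) = int (hi W x)"
    using T r by (auto simp: tables_def)
  ultimately show ?thesis
    using r m unfolding aligned_test_def aligned_def
    by (simp add: linorder_not_less del: mod_eq_0_iff_dvd of_nat_diff)
qed

lemma shift_prog:
  assumes T: "tables A W s" and mono: "\<And>i j. i \<le> j \<Longrightarrow> j < n \<Longrightarrow> W i \<le> W j"
    and r: "var s r = int x" "x < n" and m: "var s (b + 4) = int m" "m \<le> n" and al: "aligned W m x"
  shows "halts_within w (shift_prog r r') s 20 (\<lambda>s'. var s' r' = int (shift W m x))"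
proof -
  note b = lo_hi_self[of W x, OF mono r(2)] hi_le[of W x]
  have "m \<le> hi W x" using al b by (auto simp: aligned_def)
  then obtain k where k: "hi W x = m + k" by (metis le_Suc_ex)
  have "is_word w (int x)" "is_word w (int m)" "is_word w (int (hi W x))"
    "is_word w (int k)" by (rule is_word_nat; use b r(2) k m in linarith)+
  moreover have "is_word w (int x + int m)"
    using r(2) m square_bound by (intro is_wordI) auto
  moreover have "arr s (b + 3) (int x) = int (hi W x)"
    using T r by (auto simp: tables_def)
  moreover have "int (hi W x) - int m = int k" "hi W x - m = k" using k by linarith+
  moreover have "int (hi W x) < int x + int m \<longleftrightarrow> hi W x < x + m" by linarith
  ultimately show ?thesis
    using r m by (simp add: shift_prog_def halts_within_wp wp_simps shift_def del: of_nat_diff)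
qed

lemma cell_prog:
  assumes ws: "word_state w s" and T: "tables A W s" and mono: "\<And>i j. i \<le> j \<Longrightarrow> j < n \<Longrightarrow> W i \<le> W j"
    and x: "var s (b + 1) = int x" "x < n" and y: "var s (b + 2) = int y" "y < n"
    and ans: "var s (b + 9) = of_bool r"
  shows "halts_within w cell_prog s (150 + (if relevant W x y then 200 * f * (real (msize W x y))\<^sup>2 else 0))
    (\<lambda>s'. var s' (b + 9) = of_bool (r \<or> found A W x y))"
proof -
  let ?c = "first W x y" and ?m = "msize W x y"
  let ?D = "Cond (Conj (aligned_test (b + 1)) (aligned_test (b + 2)))
          (Seq (Seq (shift_prog (b + 1) (b + 5)) (shift_prog (b + 2) (b + 6))) block) Skip"
  let ?R = "\<lambda>s'. var s' (b + 9) = of_bool (r \<or> found A W x y)"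
  let ?B = "if relevant W x y then 200 * f * (real ?m)\<^sup>2 else 0"
  have B: "0 \<le> ?B" using f_ge by auto
  have c: "arr s (b + 4) (int x * int n + int y) = int ?c" and n: "var s b = int n"
    and W: "\<And>v. v < n \<Longrightarrow> warr s b (int v) = W v"
    using T x y by (auto simp: tables_def)
  have wd: "is_word w (int x)" "is_word w (int y)" "is_word w (int ?c)"
     "is_word w (int x * int n)" "is_word w (int x * int n + int y)"
    using x y first_le[of W x y] by (auto intro: is_word_nat is_word_index)
  show ?thesis
  proof (cases "?c < n \<and> W ?c + (W x + W y) = 0")
    case False
    then have "\<not> relevant W x y" "\<not> found A W x y" by (auto simp: found_def relevant_def)
    \<comment> \<open>For \<open>?c = n\<close> the weight read there is arbitrary; the index
      comparison alone refutes the test.\<close>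
    moreover have "\<not> (?c < n \<and> warr s b (int ?c) + (W x + W y) = 0)" using False W by auto
    ultimately show ?thesis
      using c n W wd x y ans unfolding cell_prog_def halts_within_wp
      by (auto simp: wp_simps)
  next
    case True
    note m = msize_bounds[of W x y, OF mono conjunct1[OF True] conjunct2[OF True]]
    have h: "arr s (b + 3) (int ?c) = int (hi W ?c)" using T True by (auto simp: tables_def)
    have hc: "int (hi W ?c) - int ?c = int ?m" using m(3) by linarith
    let ?s = "s\<lparr>var := (var s)(b + 3 := int ?c, b + 4 := int ?m)\<rparr>"
    have wd2: "is_word w (int ?m)" "is_word w (int (hi W ?c))"
      using m hi_le[of W ?c] by (auto intro: is_word_nat)
    have D: "halts_within w ?D ?s (100 + ?B) ?R"
    proof -
      have T2: "tables A W ?s" using T by (simp add: tables_def)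
      have t1: "tok w (aligned_test (b + 1)) ?s \<and> (tval (aligned_test (b + 1)) ?s \<longleftrightarrow> aligned W ?m x)"
        by (rule aligned_test[OF T2 mono]) (use x m in auto)
      have t2: "tok w (aligned_test (b + 2)) ?s \<and> (tval (aligned_test (b + 2)) ?s \<longleftrightarrow> aligned W ?m y)"
        by (rule aligned_test[OF T2 mono]) (use y m in auto)
      have cost: "tcost (Conj (aligned_test (b + 1)) (aligned_test (b + 2))) = 35"
        by (simp add: aligned_test_def)
      show ?thesis
      proof (cases "aligned W ?m x \<and> aligned W ?m y")
        case False
        then have "\<not> relevant W x y" "\<not> found A W x y" by (auto simp: found_def relevant_def)
        then show ?thesis
          using False t1 t2 ans unfolding halts_within_wp wp_Cond cost by (auto simp: wp_Skip)
      next
        case al: True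
        then have rel: "relevant W x y" using True by (simp add: relevant_def)
        let ?x = "shift W ?m x" and ?y = "shift W ?m y"
        note sx = shift_bounds[of W x ?m, OF mono x(2) conjunct1[OF al]]
        note sy = shift_bounds[of W y ?m, OF mono y(2) conjunct2[OF al]]
        have ws2: "word_state w ?s" using ws wd wd2 by (auto simp: word_state_def)
        have "halts_within w (Seq (Seq (shift_prog (b + 1) (b + 5)) (shift_prog (b + 2) (b + 6))) block) ?s
            (40 + 200 * f * (real ?m)\<^sup>2) ?R"
        proof (rule halts_within_Seq[OF _ ws2 _ order.refl])
          show "halts_within w (Seq (shift_prog (b + 1) (b + 5)) (shift_prog (b + 2) (b + 6))) ?s 40
              (\<lambda>s'. var s' (b + 5) = int ?x \<and> var s' (b + 6) = int ?y)"
          proof (rule halts_within_Seq[OF shift_prog[OF T2 mono, where x = x and m = ?m] ws2])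
            fix s1 assume 1: "var s1 (b + 5) = int ?x" "agree (shift_prog (b + 1) (b + 5)) ?s s1" "word_state w s1"
            have "halts_within w (shift_prog (b + 2) (b + 6)) s1 20 (\<lambda>s'. var s' (b + 6) = int ?y)"
            proof (rule shift_prog[where W = W and x = y and m = ?m, OF _ mono])
              show "tables A W s1" using T2 1(2) by (simp add: tables_def agree_def shift_prog_def)
            qed (use 1(2) y m al in \<open>auto simp: agree_def shift_prog_def\<close>)
            from halts_within_frame[OF this 1(3)]
            show "halts_within w (shift_prog (b + 2) (b + 6)) s1 20
                (\<lambda>s'. var s' (b + 5) = int ?x \<and> var s' (b + 6) = int ?y)"
              by (rule halts_within_mono) (use 1 in \<open>auto simp: agree_def shift_prog_def\<close>)
          qed (use x m al in auto)
          fix s1 assume 1: "var s1 (b + 5) = int ?x \<and> var s1 (b + 6) = int ?y"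
            "agree (Seq (shift_prog (b + 1) (b + 5)) (shift_prog (b + 2) (b + 6))) ?s s1" "word_state w s1"
          have regs: "block_regs A ?c ?m ?x ?y s1" and ans1: "var s1 (b + 9) = of_bool r"
            using 1 T2 ans by (auto simp: block_regs_def tables_def agree_def shift_prog_def)
          have "found A W x y \<longleftrightarrow> block_triangle A ?c ?m ?x ?y" using rel by (simp add: found_def)
          then show "halts_within w block s1 (200 * f * (real ?m)\<^sup>2) ?R"
            using block[OF 1(3) regs _ _ _ _ _ ans1] m sx sy hi_le[of W x] hi_le[of W y]
            unfolding block_triangle_def by auto
        qed
        moreover have "real (tcost (Conj (aligned_test (b + 1)) (aligned_test (b + 2)))) +
            (40 + 200 * f * (real ?m)\<^sup>2) \<le> 100 + ?B"
          unfolding cost using rel by simp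
        ultimately show ?thesis
          using al t1 t2 by (intro halts_within_CondTrue) auto
      qed
    qed
    have "wp w (Seq (Assign (b + 4) (Bin Sub (Arr (b + 3) (Var (b + 3))) (Var (b + 3)))) ?D) (in_time ?R)
      (s\<lparr>var := (var s)(b + 3 := int ?c)\<rparr>) (120 + ?B)"
      unfolding wp_Seq wp_Assign
    proof
      show "wok w (Bin Sub (Arr (b + 3) (Var (b + 3))) (Var (b + 3))) (s\<lparr>var := (var s)(b + 3 := int ?c)\<rparr>)"
        using wd wd2 h hc by simp
      have "(s\<lparr>var := (var s)(b + 3 := int ?c)\<rparr>)\<lparr>var := (var (s\<lparr>var := (var s)(b + 3 := int ?c)\<rparr>))(b + 4 :=
         wval (Bin Sub (Arr (b + 3) (Var (b + 3))) (Var (b + 3))) (s\<lparr>var := (var s)(b + 3 := int ?c)\<rparr>))\<rparr> = ?s"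
        using h hc by simp
      moreover have "wp w ?D (in_time ?R) ?s (120 + ?B - real (wcost (Bin Sub (Arr (b + 3) (Var (b + 3))) (Var (b + 3))) + 1))"
        unfolding halts_within_wp[symmetric] by (rule halts_within_mono[OF D]) auto
      ultimately show "wp w ?D (in_time ?R) ((s\<lparr>var := (var s)(b + 3 := int ?c)\<rparr>)\<lparr>var := (var (s\<lparr>var := (var s)(b + 3 := int ?c)\<rparr>))(b + 4 :=
         wval (Bin Sub (Arr (b + 3) (Var (b + 3))) (Var (b + 3))) (s\<lparr>var := (var s)(b + 3 := int ?c)\<rparr>))\<rparr>)
         (120 + ?B - real (wcost (Bin Sub (Arr (b + 3) (Var (b + 3))) (Var (b + 3))) + 1))"
        by (simp only:)
    qed
    then have E: "halts_within w (Seq (Assign (b + 4) (Bin Sub (Arr (b + 3) (Var (b + 3))) (Var (b + 3)))) ?D)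
      (s\<lparr>var := (var s)(b + 3 := int ?c)\<rparr>) (120 + ?B) ?R"
      by (simp only: halts_within_wp)
    show ?thesis
      unfolding cell_prog_def
    proof (rule halts_within_Seq[where ?T1.0 = 7 and ?T2.0 = "140 + ?B" and
          Q = "\<lambda>s'. s' = s\<lparr>var := (var s)(b + 3 := int ?c)\<rparr>", OF _ ws])
      show "halts_within w (Assign (b + 3) (Arr (b + 4) (Bin Add (Bin Mul (Var (b + 1)) (Var b)) (Var (b + 2))))) s 7
         (\<lambda>s'. s' = s\<lparr>var := (var s)(b + 3 := int ?c)\<rparr>)"
        using c n wd x y unfolding halts_within_wp by (simp add: wp_simps)
      fix s' assume s': "s' = s\<lparr>var := (var s)(b + 3 := int ?c)\<rparr>"
      let ?b = "Conj (Less (Var (b + 3)) (Var b))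
        (WtEq (WtAdd (WtArr b (Var (b + 3))) (WtAdd (WtArr b (Var (b + 1))) (WtArr b (Var (b + 2))))) WtZero)"
      have "tok w ?b s'" "tval ?b s'" using s' wd n W True x y by auto
      moreover have "real (tcost ?b) + (120 + ?B) \<le> 140 + ?B" by simp
      ultimately show "halts_within w (Cond ?b (Seq (Assign (b + 4) (Bin Sub (Arr (b + 3) (Var (b + 3))) (Var (b + 3)))) ?D) Skip)
         s' (140 + ?B) ?R"
        using E unfolding s' by (intro halts_within_CondTrue)
    qed (use B in auto)
  qed
qed

end


section \<open>Counting how often a cell is covered\<close>

lemma aligned_unique:
  fixes l x u m :: nat
  assumes "l \<le> x" "(x - l) mod m = 0" "x \<le> u" "u < x + m"
  shows "x = l + (u - l) div m * m"
proof -
  obtain q where q: "x - l = m * q" using assms(2) by (auto simp: dvd_def mod_eq_0_iff_dvd)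
  have "u - l = m * q + (u - x)" "u - x < m" using q assms by linarith+
  then have "(u - l) div m = q" by (metis add.right_neutral div_less div_mult_self4 less_nat_zero_code)
  then show ?thesis using q assms(1) by (simp add: mult.commute)
qed

context ram
begin

lemma first_cong: "W x = W x' \<Longrightarrow> W y = W y' \<Longrightarrow> first W x y = first W x' y'"
  by (simp add: first_def)

definition block_cells :: "(nat \<Rightarrow> int) \<Rightarrow> nat \<Rightarrow> nat \<Rightarrow> (nat \<times> nat) set" where
  "block_cells W x y = (let m = msize W x y in
     {shift W m x..<shift W m x + m} \<times> {shift W m y..<shift W m y + m})"

lemma card_block_cells: "card (block_cells W x y) = (msize W x y)\<^sup>2"
  by (simp add: block_cells_def Let_def power2_eq_square)

text \<open>An unmoved block starts at \<open>u\<close> rounded down to a block start. A block that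
  was moved back is the last of its class, so \<open>x\<close> is the last position of the class
  rounded down. Both candidates depend on \<open>u\<close> and \<open>m\<close> only, because
  \<open>u\<close> and \<open>x\<close> lie in the same class.\<close>

lemma covering_positions:
  assumes mono: "\<And>i j. i \<le> j \<Longrightarrow> j < n \<Longrightarrow> W i \<le> W j" and "x < n" "aligned W m x"
    and u: "u \<in> {shift W m x..<shift W m x + m}"
  shows "u < n \<and> W u = W x \<and> x \<in> {lo W u + (u - lo W u) div m * m, lo W u + (hi W u - 1 - lo W u) div m * m}"
proof -
  note b = shift_bounds[of W x m, OF mono assms(2,3)] hi_le[of W x] lo_hi_self[of W x, OF mono assms(2)]
  have "u < n" "lo W x \<le> u" "u < hi W x" using b u by auto
  then have Wu: "W u = W x" using class_iff[of W u x, OF mono] by simp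
  then have lh: "lo W u = lo W x" "hi W u = hi W x" using lo_hi_cong[OF Wu] by auto
  have al: "(x - lo W x) mod m = 0" using assms(3) by (simp add: aligned_def)
  have "x \<in> {lo W u + (u - lo W u) div m * m, lo W u + (hi W u - 1 - lo W u) div m * m}"
  proof (cases "hi W x < x + m")
    case True
    \<comment> \<open>The unmoved window of \<open>x\<close> overhangs the class, so it contains the
      last position \<open>hi W x - 1\<close>.\<close>
    then have "x = lo W x + (hi W x - 1 - lo W x) div m * m"
      using b al by (intro aligned_unique) auto
    then show ?thesis using lh by simp
  next
    case False
    then have "x = lo W x + (u - lo W x) div m * m"
      using b al u by (intro aligned_unique) (auto simp: shift_def)
    then show ?thesis using lh by simp
  qed
  then show ?thesis using \<open>u < n\<close> Wu by blast
qed

text \<open>Double counting of incidences between block pairs and cells. The corners of all block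
  pairs covering a given cell lie in a product of two sets with at most two elements each, whence
  the 4.\<close>

lemma sum_msize_le:
  assumes mono: "\<And>i j. i \<le> j \<Longrightarrow> j < n \<Longrightarrow> W i \<le> W j"
  shows "(\<Sum>x<n. \<Sum>y<n. if relevant W x y then (msize W x y)\<^sup>2 else 0) \<le> 4 * n\<^sup>2"
proof -
  let ?N = "{..<n} \<times> {..<n}"
  let ?S = "{p \<in> ?N. relevant W (fst p) (snd p)}"
  let ?C = "\<lambda>p. block_cells W (fst p) (snd p)"
  have pos: "fst q < n \<and> snd q < n \<and> p \<in>
      {lo W (fst q) + (fst q - lo W (fst q)) div m * m, lo W (fst q) + (hi W (fst q) - 1 - lo W (fst q)) div m * m} \<times>
      {lo W (snd q) + (snd q - lo W (snd q)) div m * m, lo W (snd q) + (hi W (snd q) - 1 - lo W (snd q)) div m * m}"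
    if "p \<in> ?S" "q \<in> ?C p" and m: "m = msize W (fst q) (snd q)" for p q m
  proof -
    have q: "fst q \<in> {shift W (msize W (fst p) (snd p)) (fst p)..<shift W (msize W (fst p) (snd p)) (fst p) + msize W (fst p) (snd p)}"
      "snd q \<in> {shift W (msize W (fst p) (snd p)) (snd p)..<shift W (msize W (fst p) (snd p)) (snd p) + msize W (fst p) (snd p)}"
      using that(2) by (auto simp: block_cells_def Let_def)
    have al: "aligned W (msize W (fst p) (snd p)) (fst p)" "aligned W (msize W (fst p) (snd p)) (snd p)"
      "fst p < n" "snd p < n"
      using that(1) by (auto simp: relevant_def)
    note c = covering_positions[of W "fst p" "msize W (fst p) (snd p)", OF mono al(3) al(1) q(1)]
      covering_positions[of W "snd p" "msize W (fst p) (snd p)", OF mono al(4) al(2) q(2)]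
    \<comment> \<open>Blocks stay inside their classes and \<open>msize\<close> depends on the two
      weights only, so a cell knows the block length of everything that covers it.\<close>
    have "msize W (fst p) (snd p) = m"
      using c m first_cong[of W "fst p" "fst q" "snd p" "snd q"] by (simp add: msize_def)
    then show ?thesis using c by (cases p) auto
  qed
  have C_sub: "?C p \<subseteq> ?N" if "p \<in> ?S" for p using pos[OF that] by (auto simp: mem_Times_iff)
  have "(\<Sum>x<n. \<Sum>y<n. if relevant W x y then (msize W x y)\<^sup>2 else 0)
      = (\<Sum>p\<in>?N. if relevant W (fst p) (snd p) then (msize W (fst p) (snd p))\<^sup>2 else 0)"
    by (simp add: sum.cartesian_product case_prod_beta)
  also have "\<dots> = (\<Sum>p\<in>?S. card (?C p))"
    unfolding card_block_cells by (subst sum.inter_filter) simp_all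
  also have "\<dots> = (\<Sum>p\<in>?S. card {q \<in> ?N. q \<in> ?C p})"
    using C_sub by (intro sum.cong refl arg_cong[where f = card]) blast
  also have "\<dots> = (\<Sum>q\<in>?N. card {p \<in> ?S. q \<in> ?C p})"
    by (rule sum_multicount_gen) auto
  also have "\<dots> \<le> (\<Sum>q\<in>?N. 4)"
  proof (rule sum_mono)
    fix q
    let ?m = "msize W (fst q) (snd q)"
    let ?X = "{lo W (fst q) + (fst q - lo W (fst q)) div ?m * ?m, lo W (fst q) + (hi W (fst q) - 1 - lo W (fst q)) div ?m * ?m}"
    let ?Y = "{lo W (snd q) + (snd q - lo W (snd q)) div ?m * ?m, lo W (snd q) + (hi W (snd q) - 1 - lo W (snd q)) div ?m * ?m}"
    have "{p \<in> ?S. q \<in> ?C p} \<subseteq> ?X \<times> ?Y" using pos[of _ q ?m] by blast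
    then have "card {p \<in> ?S. q \<in> ?C p} \<le> card (?X \<times> ?Y)" by (intro card_mono) auto
    also have "\<dots> = card ?X * card ?Y" by (rule card_cartesian_product)
    also have "\<dots> \<le> 2 * 2" by (intro mult_le_mono) (auto simp: card_insert_if)
    finally show "card {p \<in> ?S. q \<in> ?C p} \<le> 4" by simp
  qed
  also have "\<dots> = 4 * n\<^sup>2" by (simp add: power2_eq_square)
  finally show ?thesis .
qed

section \<open>Correctness of the block search\<close>

lemma found_sound:
  assumes mono: "\<And>i j. i \<le> j \<Longrightarrow> j < n \<Longrightarrow> W i \<le> W j" and "x < n" "y < n" "found A W x y"
  shows "\<exists>i<n. \<exists>j<n. \<exists>k<n. A i k \<and> A k j \<and> A i j \<and> W i + W j + W k = 0"
proof -
  let ?c = "first W x y" and ?m = "msize W x y"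
  have c: "?c < n" "W ?c + (W x + W y) = 0" and al: "aligned W ?m x" "aligned W ?m y"
    using assms(4) by (auto simp: found_def relevant_def)
  obtain i j l where ijl: "i < ?m" "j < ?m" "l < ?m" and A: "A (shift W ?m x + i) (?c + l)"
    "A (?c + l) (shift W ?m y + j)" "A (shift W ?m x + i) (shift W ?m y + j)"
    using assms(4) unfolding found_def block_triangle_def by blast
  have "shift W ?m x + i < n \<and> W (shift W ?m x + i) = W x"
    using covering_positions[of W x ?m "shift W ?m x + i", OF mono assms(2) al(1)] ijl by simp
  moreover have "shift W ?m y + j < n \<and> W (shift W ?m y + j) = W y"
    using covering_positions[of W y ?m "shift W ?m y + j", OF mono assms(3) al(2)] ijl by simp
  moreover have "?c + l < n" "W (?c + l) = W ?c"
    using msize_bounds[of W x y, OF mono c] ijl class_iff[of W "?c + l" ?c, OF mono] lo_hi_self[of W ?c, OF mono c(1)]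
    by auto
  ultimately show ?thesis using A c(2)
    by (intro exI[of _ "shift W ?m x + i"] exI[of _ "shift W ?m y + j"] exI[of _ "?c + l"] conjI)
      (simp_all add: add_ac)
qed

text \<open>Rounding \<open>i\<close> down gives the block. If that block has to be moved back, it
  still covers \<open>i\<close>, because it moves to the left and then ends where the class of
  \<open>i\<close> ends.\<close>

lemma block_start:
  assumes mono: "\<And>i j. i \<le> j \<Longrightarrow> j < n \<Longrightarrow> W i \<le> W j" and "i < n" "1 \<le> m" "m \<le> hi W i - lo W i"
  obtains x where "x < n" "W x = W i" "aligned W m x" "\<exists>p<m. i = shift W m x + p"
proof -
  let ?x = "lo W i + (i - lo W i) div m * m"
  note b = lo_hi_self[of W i, OF mono assms(2)]
  have d: "i - lo W i = (i - lo W i) div m * m + (i - lo W i) mod m" by simp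
  have "(i - lo W i) mod m < m" using assms(3) by simp
  with d b have x: "?x \<le> i" "i < ?x + m" by linarith+
  then have xn: "?x < n" using assms(2) by simp
  have Wx: "W ?x = W i" using class_iff[of W ?x i, OF mono xn] x b by simp
  have lh: "lo W ?x = lo W i" "hi W ?x = hi W i" using lo_hi_cong[OF Wx] by auto
  have "aligned W m ?x" unfolding aligned_def lh using assms(4) by simp
  moreover have "\<exists>p<m. i = shift W m ?x + p"
    using x b assms(4) by (intro exI[of _ "i - shift W m ?x"]) (auto simp: shift_def lh)
  ultimately show thesis using that xn Wx by blast
qed

lemma found_complete:
  assumes mono: "\<And>i j. i \<le> j \<Longrightarrow> j < n \<Longrightarrow> W i \<le> W j"
    and ijk: "i < n" "j < n" "k < n" and A: "A i k" "A k j" "A i j" and sum: "W k + (W i + W j) = 0"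
    and size: "hi W k - lo W k \<le> hi W i - lo W i" "hi W k - lo W k \<le> hi W j - lo W j"
  shows "\<exists>x<n. \<exists>y<n. found A W x y"
proof -
  let ?m = "hi W k - lo W k"
  note b = lo_hi_self[of W k, OF mono ijk(3)] hi_le[of W k]
  have m: "1 \<le> ?m" using b by simp
  obtain x where x: "x < n" "W x = W i" "aligned W ?m x" "\<exists>p<?m. i = shift W ?m x + p"
    using block_start[of W i ?m, OF mono ijk(1) m size(1)] by blast
  obtain y where y: "y < n" "W y = W j" "aligned W ?m y" "\<exists>q<?m. j = shift W ?m y + q"
    using block_start[of W j ?m, OF mono ijk(2) m size(2)] by blast
  have c: "first W x y = lo W k" using sum x y by (intro first_eq_lo) simp
  have "W (lo W k) = W k" using class_iff[of W "lo W k" k, OF mono] b by simp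
  moreover from this have "hi W (lo W k) = hi W k" using lo_hi_cong by blast
  ultimately have ms: "msize W x y = ?m" by (simp add: msize_def c)
  have "relevant W x y" unfolding relevant_def ms c
    using \<open>W (lo W k) = W k\<close> b x y sum by simp
  moreover have "block_triangle A (lo W k) ?m (shift W ?m x) (shift W ?m y)"
  proof -
    obtain p q where pq: "p < ?m" "i = shift W ?m x + p" "q < ?m" "j = shift W ?m y + q"
      using x(4) y(4) by blast
    have "k - lo W k < ?m" "k = lo W k + (k - lo W k)" using b by auto
    with pq A show ?thesis unfolding block_triangle_def by metis
  qed
  ultimately have "found A W x y" unfolding found_def ms c by blast
  then show ?thesis using x y by blast
qed

lemma found_iff:
  assumes mono: "\<And>i j. i \<le> j \<Longrightarrow> j < n \<Longrightarrow> W i \<le> W j" and sym: "\<And>i j. A i j \<longleftrightarrow> A j i"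
  shows "(\<exists>x<n. \<exists>y<n. found A W x y) \<longleftrightarrow>
    (\<exists>i<n. \<exists>j<n. \<exists>k<n. A i j \<and> A j k \<and> A i k \<and> W i + W j + W k = 0)"
proof
  assume "\<exists>x<n. \<exists>y<n. found A W x y"
  then obtain i j k where "i < n" "j < n" "k < n" "A i k" "A k j" "A i j" "W i + W j + W k = 0"
    using found_sound[of W _ _ A, OF mono] by blast
  then show "\<exists>i<n. \<exists>j<n. \<exists>k<n. A i j \<and> A j k \<and> A i k \<and> W i + W j + W k = 0"
    using sym by blast
next
  assume "\<exists>i<n. \<exists>j<n. \<exists>k<n. A i j \<and> A j k \<and> A i k \<and> W i + W j + W k = 0"
  then obtain i j k where ijk: "i < n" "j < n" "k < n" "A i j" "A j k" "A i k" "W i + W j + W k = 0"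
    by blast
  let ?s = "\<lambda>v. hi W v - lo W v"
  \<comment> \<open>A vertex from a smallest class is given the role of the third one; the symmetry
    of \<open>A\<close> allows this relabelling.\<close>
  consider "?s k \<le> ?s i \<and> ?s k \<le> ?s j" | "?s j \<le> ?s i \<and> ?s j \<le> ?s k" | "?s i \<le> ?s j \<and> ?s i \<le> ?s k"
    by linarith
  then show "\<exists>x<n. \<exists>y<n. found A W x y"
  proof cases
    case 1
    then show ?thesis using ijk sym by (intro found_complete[of W i j k, OF mono]) auto
  next
    case 2
    then show ?thesis using ijk sym by (intro found_complete[of W i k j, OF mono]) auto
  next
    case 3
    then show ?thesis using ijk sym by (intro found_complete[of W j k i, OF mono]) auto
  qed
qed

end

section \<open>Total cost of the search\<close>

context ram_mult
begin

text \<open>The products cost \<open>200 * f\<close> times the sum of all \<open>m\<^sup>2\<close>,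
  hence at most \<open>800 * f * n\<^sup>2\<close>; tests and loop control are quadratic and fit
  into the rest because \<open>1 \<le> f\<close>.\<close>

lemma main_prog:
  assumes ws: "word_state w s" and T: "tables A W s" and mono: "\<And>i j. i \<le> j \<Longrightarrow> j < n \<Longrightarrow> W i \<le> W j"
  shows "halts_within w main_prog s (1000 * f * (real n)\<^sup>2)
    (\<lambda>s'. var s' 0 = of_bool (\<exists>x<n. \<exists>y<n. found A W x y))"
proof -
  let ?t = "\<lambda>x y. 150 + (if relevant W x y then 200 * f * (real (msize W x y))\<^sup>2 else 0)"
  let ?row = "For (b + 2) b cell_prog"
  let ?loop = "For (b + 1) b ?row"
  have loop: "halts_within w ?loop s1 ((\<Sum>x<n. (\<Sum>y<n. ?t x y) + 7 * real n + 5) + 7 * real n + 5)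
      (\<lambda>s'. var s' (b + 9) = of_bool (\<exists>x<n. \<exists>y<n. found A W x y))"
    if s1: "word_state w s1" "tables A W s1" "var s1 (b + 9) = 0" for s1
  proof (rule halts_within_For[where k = n and I = "\<lambda>i s'. var s' (b + 9) = of_bool (\<exists>x<i. \<exists>y<n. found A W x y)"
        and T = "\<lambda>x. (\<Sum>y<n. ?t x y) + 7 * real n + 5"])
    fix x s2
    assume x: "x < n" and r: "var s2 (b + 9) = of_bool (\<exists>z<x. \<exists>y<n. found A W z y)"
      and vx: "var s2 (b + 1) = int x" and ag: "agree ?loop s1 s2" and ws2: "word_state w s2"
    have T2: "tables A W s2" using s1(2) ag b_ge by (auto simp: tables_def agree_def wr_cell wr_block)
    define R where "R \<longleftrightarrow> (\<exists>z<x. \<exists>y<n. found A W z y)"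
    have "halts_within w ?row s2 ((\<Sum>y<n. ?t x y) + 7 * real n + 5)
        (\<lambda>s'. var s' (b + 9) = of_bool (R \<or> (\<exists>y<n. found A W x y)))"
    proof (rule halts_within_For[where k = n and I = "\<lambda>i s'. var s' (b + 9) = of_bool (R \<or> (\<exists>y<i. found A W x y))"])
      fix y s3
      assume y: "y < n" and r3: "var s3 (b + 9) = of_bool (R \<or> (\<exists>z<y. found A W x z))"
        and vy: "var s3 (b + 2) = int y" and ag3: "agree ?row s2 s3" and ws3: "word_state w s3"
      have T3: "tables A W s3" using T2 ag3 b_ge by (auto simp: tables_def agree_def wr_cell wr_block)
      have vx3: "var s3 (b + 1) = int x" using vx ag3 b_ge by (auto simp: agree_def wr_cell wr_block)
      have "R \<or> (\<exists>z<Suc y. found A W x z) \<longleftrightarrow> (R \<or> (\<exists>z<y. found A W x z)) \<or> found A W x y"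
        unfolding Ex_less_Suc by blast
      then show "halts_within w cell_prog s3 (?t x y) (\<lambda>s'. var s' (b + 9) = of_bool (R \<or> (\<exists>z<Suc y. found A W x z)))"
        using cell_prog[OF ws3 T3 mono vx3 x vy y r3] by (simp only:)
    qed (use ws2 T2 r b_ge in \<open>auto simp: tables_def wr_cell wr_block R_def\<close>)
    moreover have "R \<or> (\<exists>y<n. found A W x y) \<longleftrightarrow> (\<exists>z<Suc x. \<exists>y<n. found A W z y)"
      unfolding R_def Ex_less_Suc by blast
    ultimately show "halts_within w ?row s2 ((\<Sum>y<n. ?t x y) + 7 * real n + 5)
        (\<lambda>s'. var s' (b + 9) = of_bool (\<exists>z<Suc x. \<exists>y<n. found A W z y))"
      by (simp only:)
  qed (use s1 b_ge in \<open>auto simp: tables_def wr_cell wr_block\<close>)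
  have "(\<Sum>x<n. \<Sum>y<n. ?t x y) = 150 * (real n)\<^sup>2 +
      200 * f * real (\<Sum>x<n. \<Sum>y<n. if relevant W x y then (msize W x y)\<^sup>2 else 0)"
    by (simp add: sum.distrib sum_distrib_left power2_eq_square if_distrib[of real] if_distrib[of "\<lambda>t. _ * t"] cong: if_cong)
  also have "\<dots> \<le> 150 * (real n)\<^sup>2 + 200 * f * real (4 * n\<^sup>2)"
    using sum_msize_le[of W, OF mono] f_ge by (intro add_left_mono mult_left_mono) (simp_all only: of_nat_le_iff)
  finally have le: "(\<Sum>x<n. (\<Sum>y<n. ?t x y) + 7 * real n + 5) \<le> 157 * (real n)\<^sup>2 + 800 * f * (real n)\<^sup>2 + 5 * real n"
    by (simp add: sum.distrib power2_eq_square)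
  have ge: "(real n)\<^sup>2 \<le> f * (real n)\<^sup>2" using mult_right_mono[OF f_ge, of "(real n)\<^sup>2"] by simp
  show ?thesis
    unfolding main_prog_def
  proof (rule halts_within_Seq[OF _ ws, where ?T1.0 = 2 and
        ?T2.0 = "(\<Sum>x<n. (\<Sum>y<n. ?t x y) + 7 * real n + 5) + 7 * real n + 7"])
    show "halts_within w (Assign (b + 9) (Lit 0)) s 2 (\<lambda>s'. var s' (b + 9) = 0)"
      by (simp add: halts_within_wp wp_simps)
    fix s1 assume 1: "var s1 (b + 9) = 0" "agree (Assign (b + 9) (Lit 0)) s s1" "word_state w s1"
    have "tables A W s1" using T 1(2) by (simp add: tables_def agree_def)
    from loop[OF 1(3) this 1(1)]
    show "halts_within w (Seq ?loop (Assign 0 (Var (b + 9)))) s1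
        ((\<Sum>x<n. (\<Sum>y<n. ?t x y) + 7 * real n + 5) + 7 * real n + 7)
        (\<lambda>s'. var s' 0 = of_bool (\<exists>x<n. \<exists>y<n. found A W x y))"
    proof (rule halts_within_Seq[OF _ 1(3), where ?T2.0 = 2])
      fix s2 assume "var s2 (b + 9) = of_bool (\<exists>x<n. \<exists>y<n. found A W x y)" "word_state w s2"
      then show "halts_within w (Assign 0 (Var (b + 9))) s2 2 (\<lambda>s'. var s' 0 = of_bool (\<exists>x<n. \<exists>y<n. found A W x y))"
        unfolding halts_within_wp wp_Assign by (simp add: word_state_def)
    qed simp
  next
    show "2 + ((\<Sum>x<n. (\<Sum>y<n. ?t x y) + 7 * real n + 5) + 7 * real n + 7) \<le> 1000 * f * (real n)\<^sup>2"
      using le ge square_real by linarith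
  qed
qed

end


section \<open>From positions back to vertices: the complete program\<close>

lemma zero_triangle_iff:
  assumes "simple_graph V E" "bij_betw \<sigma> I V"
  shows "zero_triangle E wt \<longleftrightarrow> (\<exists>i\<in>I. \<exists>j\<in>I. \<exists>k\<in>I. {\<sigma> i, \<sigma> j} \<in> E \<and> {\<sigma> j, \<sigma> k} \<in> E \<and>
    {\<sigma> i, \<sigma> k} \<in> E \<and> wt (\<sigma> i) + wt (\<sigma> j) + wt (\<sigma> k) = 0)"
proof
  assume "zero_triangle E wt"
  then obtain x y z where E: "{x, y} \<in> E" "{y, z} \<in> E" "{x, z} \<in> E" and 0: "wt x + wt y + wt z = 0"
    unfolding zero_triangle_def by blast
  have "x \<in> V" "y \<in> V" "z \<in> V" using E assms(1) by (auto simp: simple_graph_def)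
  then obtain i j k where "i \<in> I" "j \<in> I" "k \<in> I" "x = \<sigma> i" "y = \<sigma> j" "z = \<sigma> k"
    using assms(2) by (auto simp: bij_betw_def)
  with E 0 show "\<exists>i\<in>I. \<exists>j\<in>I. \<exists>k\<in>I. {\<sigma> i, \<sigma> j} \<in> E \<and> {\<sigma> j, \<sigma> k} \<in> E \<and>
    {\<sigma> i, \<sigma> k} \<in> E \<and> wt (\<sigma> i) + wt (\<sigma> j) + wt (\<sigma> k) = 0" by blast
qed (auto simp: zero_triangle_def)

context ram_mult
begin

definition copy_prog :: prog where
  "copy_prog = fill (b + 1) (b + 2) b b
     (Arr 0 (Bin Add (Bin Mul (Arr (b + 1) (Var (b + 1))) (Var b)) (Arr (b + 1) (Var (b + 2)))))"

text \<open>Register 0 and array 0 are reused as arguments of the multiplication, so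
  \<open>n\<close> is saved in register \<open>b\<close> and the graph survives only as the sorted
  copy in array \<open>b\<close>.\<close>

definition nwt_prog :: prog where
  "nwt_prog = Seq (Assign b (Var 0)) (Seq rank_prog (Seq copy_prog (Seq bounds_prog (Seq ptr_prog main_prog))))"

lemma wr_progs:
  "wr_var rank_prog = {b + 1, b + 2, b + 3}" "wr_arr rank_prog = {b + 1}" "wr_warr rank_prog = {b}"
  "wr_var bounds_prog = {b + 1, b + 2, b + 3, b + 4}" "wr_arr bounds_prog = {b + 2, b + 3}" "wr_warr bounds_prog = {}"
  "wr_var ptr_prog = {b + 1, b + 2, b + 3}" "wr_arr ptr_prog = {b + 4}" "wr_warr ptr_prog = {}"
  by (auto simp: rank_prog_def rank_step_def bounds_prog_def bounds_step_def ptr_prog_def ptr_row_def ptr_step_def)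

lemma copy_prog:
  assumes "word_state w s" "var s b = int n" "\<forall>i<n. arr s (b + 1) (int i) = int (\<sigma> i)" "\<And>i. i < n \<Longrightarrow> \<sigma> i < n"
    and "\<forall>i<n. \<forall>j<n. arr s 0 (int i * int n + int j) = of_bool (G i j)"
  shows "halts_within w copy_prog s (48 * (real n)\<^sup>2)
    (\<lambda>s'. \<forall>i<n. \<forall>j<n. arr s' b (int i * int n + int j) = of_bool (G (\<sigma> i) (\<sigma> j)))"
  unfolding copy_prog_def
proof (rule halts_within_mono[OF fill[where k = n and g = "\<lambda>i j. of_bool (G (\<sigma> i) (\<sigma> j))"]])
  let ?e = "Arr 0 (Bin Add (Bin Mul (Arr (b + 1) (Var (b + 1))) (Var b)) (Arr (b + 1) (Var (b + 2))))"
  fix i j s'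
  assume ij: "i < n" "j < n" "var s' (b + 1) = int i" "var s' (b + 2) = int j"
    and ag: "agree (fill (b + 1) (b + 2) b b ?e) s s'"
  have s': "var s' b = int n" "arr s' (b + 1) = arr s (b + 1)" "arr s' 0 = arr s 0"
    using ag assms b_ge by (auto simp: agree_def)
  have "\<sigma> i < n" "\<sigma> j < n" using assms(4) ij by auto
  then have "is_word w (int i)" "is_word w (int j)" "is_word w (int (\<sigma> i))" "is_word w (int (\<sigma> j))"
    "is_word w (int (\<sigma> i) * int n)" "is_word w (int (\<sigma> i) * int n + int (\<sigma> j))"
    using ij by (auto intro: is_word_nat is_word_index)
  moreover have "arr s 0 (int (\<sigma> i) * int n + int (\<sigma> j)) = of_bool (G (\<sigma> i) (\<sigma> j))"
    using assms(4,5) ij by blast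
  ultimately show "wok w ?e s' \<and> wval ?e s' = of_bool (G (\<sigma> i) (\<sigma> j))"
    using ij s' assms(3) by simp
qed (use assms n_pos in auto)

lemma nwt_prog:
  assumes ws: "word_state w s" and n: "var s 0 = int n"
    and G: "stores_mat s 0 (mat n n (\<lambda>(u, v). of_bool ({u, v} \<in> E)))"
    and wt: "\<forall>v<n. warr s 0 (int v) = wt v" and graph: "simple_graph {..<n} E"
  shows "halts_within w nwt_prog s (1300 * f * (real n)\<^sup>2) (\<lambda>s'. var s' 0 = of_bool (zero_triangle E wt))"
proof -
  let ?\<sigma> = "sorted_vertex n wt" and ?G = "\<lambda>i j. {i, j} \<in> E"
  let ?W = "\<lambda>i. wt (?\<sigma> i)" and ?A = "\<lambda>i j. {?\<sigma> i, ?\<sigma> j} \<in> E"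
  let ?Q = "\<lambda>s'. var s' 0 = of_bool (zero_triangle E wt)"
  have mono: "?W i \<le> ?W j" if "i \<le> j" "j < n" for i j using that by (rule sorted_vertex_mono)
  have Q: "(\<exists>x<n. \<exists>y<n. found ?A ?W x y) \<longleftrightarrow> zero_triangle E wt"
  proof -
    have "?A i j \<longleftrightarrow> ?A j i" for i j by (simp add: insert_commute)
    then show ?thesis
      unfolding zero_triangle_iff[OF graph sorted_vertex_bij[of n wt]]
      by (subst found_iff[of ?W ?A, OF mono]) (assumption | blast)+
  qed
  have b0: "b \<noteq> 0" using b_ge by simp
  have "halts_within w nwt_prog s (2 + (70 * (real n)\<^sup>2 + (48 * (real n)\<^sup>2 + (70 * (real n)\<^sup>2 +
      (100 * (real n)\<^sup>2 + 1000 * f * (real n)\<^sup>2))))) ?Q"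
    unfolding nwt_prog_def
  proof (rule halts_within_Seq[OF _ ws _ order.refl])
    show "halts_within w (Assign b (Var 0)) s 2 (\<lambda>s'. var s' b = int n)"
      using n by (simp add: halts_within_wp wp_simps)
    fix s1 assume 1: "var s1 b = int n" "agree (Assign b (Var 0)) s s1" "word_state w s1"
    have G1: "\<forall>i<n. \<forall>j<n. arr s1 0 (int i * int n + int j) = of_bool (?G i j)"
      and wt1: "\<forall>v<n. warr s1 0 (int v) = wt v"
      using 1(2) G wt by (auto simp: agree_def stores_mat_def)
    show "halts_within w (Seq rank_prog (Seq copy_prog (Seq bounds_prog (Seq ptr_prog main_prog)))) s1
      (70 * (real n)\<^sup>2 + (48 * (real n)\<^sup>2 + (70 * (real n)\<^sup>2 + (100 * (real n)\<^sup>2 + 1000 * f * (real n)\<^sup>2)))) ?Q"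
    proof (rule halts_within_Seq[OF rank_prog[OF 1(3,1) wt1] 1(3) _ order.refl])
      fix s2 assume 2: "\<forall>v<n. arr s2 (b + 1) (int (rank n wt v)) = int v \<and> warr s2 b (int (rank n wt v)) = wt v"
        "agree rank_prog s1 s2" "word_state w s2"
      have s2: "var s2 b = int n" "arr s2 0 = arr s1 0"
        using 1 2(2) b0 by (auto simp: agree_def wr_progs)
      \<comment> \<open>Each position is the rank of its sorted vertex; this converts tables indexed
        by ranks into tables indexed by positions.\<close>
      have \<sigma>: "\<forall>i<n. arr s2 (b + 1) (int i) = int (?\<sigma> i)" and W: "\<forall>i<n. warr s2 b (int i) = ?W i"
        using 2(1) sorted_vertex_less[of _ n wt] rank_sorted_vertex[of _ n wt] by metis+
      show "halts_within w (Seq copy_prog (Seq bounds_prog (Seq ptr_prog main_prog))) s2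
        (48 * (real n)\<^sup>2 + (70 * (real n)\<^sup>2 + (100 * (real n)\<^sup>2 + 1000 * f * (real n)\<^sup>2))) ?Q"
      proof (rule halts_within_Seq[OF copy_prog[OF 2(3) s2(1) \<sigma>, of ?G] 2(3) _ order.refl])
        show "\<forall>i<n. \<forall>j<n. arr s2 0 (int i * int n + int j) = of_bool (?G i j)"
          using G1 s2 by simp
        fix s3 assume 3: "\<forall>i<n. \<forall>j<n. arr s3 b (int i * int n + int j) = of_bool (?A i j)"
          "agree copy_prog s2 s3" "word_state w s3"
        have s3: "var s3 b = int n" "warr s3 = warr s2"
          using s2 3(2) by (auto simp: agree_def copy_prog_def)
        have W3: "\<forall>i<n. warr s3 b (int i) = ?W i" using W s3 by simp
        show "halts_within w (Seq bounds_prog (Seq ptr_prog main_prog)) s3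
          (70 * (real n)\<^sup>2 + (100 * (real n)\<^sup>2 + 1000 * f * (real n)\<^sup>2)) ?Q"
        proof (rule halts_within_Seq[OF bounds_prog[OF 3(3) s3(1) W3] 3(3) _ order.refl])
          fix s4 assume 4: "\<forall>v<n. arr s4 (b + 2) (int v) = int (card {u. u < n \<and> ?W u < ?W v}) \<and>
                arr s4 (b + 3) (int v) = int (card {u. u < n \<and> ?W u \<le> ?W v})"
            "agree bounds_prog s3 s4" "word_state w s4"
          have s4: "var s4 b = int n" "arr s4 b = arr s3 b" "warr s4 = warr s3"
            using s3 4(2) by (auto simp: agree_def wr_progs)
          have W4: "\<forall>i<n. warr s4 b (int i) = ?W i" using W3 s4 by simp
          show "halts_within w (Seq ptr_prog main_prog) s4 (100 * (real n)\<^sup>2 + 1000 * f * (real n)\<^sup>2) ?Q"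
          proof (rule halts_within_Seq[OF ptr_prog[OF 4(3) s4(1) W4 mono] 4(3) _ order.refl])
            fix s5 assume 5: "\<forall>u<n. \<forall>v<n. arr s5 (b + 4) (int u * int n + int v) = int (first ?W u v)"
              "agree ptr_prog s4 s5" "word_state w s5"
            have s5: "var s5 b = int n" "arr s5 b = arr s3 b" "arr s5 (b + 2) = arr s4 (b + 2)"
              "arr s5 (b + 3) = arr s4 (b + 3)" "warr s5 = warr s3"
              using s4 5(2) by (auto simp: agree_def wr_progs)
            have "tables ?A ?W s5"
              unfolding tables_def s5 lo_def hi_def using 3(1) W3 4(1) 5(1) by simp
            from main_prog[OF 5(3) this mono]
            show "halts_within w main_prog s5 (1000 * f * (real n)\<^sup>2) ?Q"
              unfolding Q .
          qed
        qed
      qed (rule sorted_vertex_less)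
    qed
  qed
  then show ?thesis
  proof (rule halts_within_mono)
    have "(real n)\<^sup>2 \<le> f * (real n)\<^sup>2" using mult_right_mono[OF f_ge, of "(real n)\<^sup>2"] by simp
    then show "2 + (70 * (real n)\<^sup>2 + (48 * (real n)\<^sup>2 + (70 * (real n)\<^sup>2 +
      (100 * (real n)\<^sup>2 + 1000 * f * (real n)\<^sup>2)))) \<le> 1300 * f * (real n)\<^sup>2"
      using square_real by linarith
  qed
qed

end


section \<open>The running time\<close>

text \<open>Two zero matrices of size 1 are an admissible input, and no run halts in zero
  steps.\<close>

lemma matmul_time_ge_1:
  assumes "matmul_time d MM"
  shows "1 \<le> MM 1 1 1"
proof -
  obtain P k where P: "\<And>w a b c A B s.
      a \<ge> 1 \<and> b \<ge> 1 \<and> c \<ge> 1 \<and> long_words k (a + b + c) w \<and>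
      A \<in> carrier_mat a b \<and> bounded_mat (int (a + b + c) ^ d) A \<and>
      B \<in> carrier_mat b c \<and> bounded_mat (int (a + b + c) ^ d) B \<and>
      word_state w s \<and> var s 0 = int a \<and> var s 1 = int b \<and> var s 2 = int c \<and>
      stores_mat s 0 A \<and> stores_mat s 1 B \<longrightarrow>
      halts_within w P s (MM a b c) (\<lambda>s'. stores_mat s' 2 (A * B))"
    using assms unfolding matmul_time_def by blast
  let ?s = "\<lparr>var = \<lambda>_. 1, arr = \<lambda>_ _. 0, wvar = \<lambda>_. 0, warr = \<lambda>_ _. 0\<rparr>"
  \<comment> \<open>\<open>2 * k\<close> bits satisfy \<open>long_words\<close>, as the base is 4;
    the extra bit lets the register value 1 fit even for \<open>k = 0\<close>.\<close>
  let ?w = "2 * k + 1"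
  have "(1::int) < 2 ^ ?w" by (intro one_less_power) auto
  then have "word_state ?w ?s" by (simp add: word_state_def is_word_def)
  moreover have "long_words k (1 + 1 + 1) ?w"
  proof -
    have "(1 + 1 + 1 + 1 :: nat) ^ k = (2 ^ 2) ^ k" by (rule arg_cong[where f = "\<lambda>x. x ^ k"]) simp
    then show ?thesis unfolding long_words_def by (simp add: power_mult)
  qed
  ultimately have "halts_within ?w P ?s (MM 1 1 1) (\<lambda>s'. stores_mat s' 2 (0\<^sub>m 1 1 * 0\<^sub>m 1 1))"
    by (intro P[rule_format]) (simp_all add: bounded_mat_def stores_mat_def)
  then obtain t where "1 \<le> t" "real t \<le> MM 1 1 1"
    unfolding halts_within_def using exec_pos by blast
  then show ?thesis by linarith
qed

theorem theorem1:
  fixes MM :: "nat \<Rightarrow> nat \<Rightarrow> nat \<Rightarrow> real" and d :: nat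
  assumes "matmul_time d MM"
    and "mono_on {1..} (\<lambda>n. MM n n n / real n ^ 2)"
  shows "\<exists>T. nwt_solvable_in_time T \<and> T \<in> O(\<lambda>n. MM n n n)"
proof (intro exI conjI)
  show "(\<lambda>n. 1300 * MM n n n) \<in> O(\<lambda>n. MM n n n)" by simp
  obtain P k where P: "\<And>w a b c A B s.
      a \<ge> 1 \<and> b \<ge> 1 \<and> c \<ge> 1 \<and> long_words k (a + b + c) w \<and>
      A \<in> carrier_mat a b \<and> bounded_mat (int (a + b + c) ^ d) A \<and>
      B \<in> carrier_mat b c \<and> bounded_mat (int (a + b + c) ^ d) B \<and>
      word_state w s \<and> var s 0 = int a \<and> var s 1 = int b \<and> var s 2 = int c \<and>
      stores_mat s 0 A \<and> stores_mat s 1 B \<longrightarrow>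
      halts_within w P s (MM a b c) (\<lambda>s'. stores_mat s' 2 (A * B))"
    using assms(1) unfolding matmul_time_def by blast
  obtain c where c: "\<forall>x\<in>wr_var P \<union> wr_arr P \<union> wr_warr P. x < c"
    using finite_writes[of P] by (metis finite_Un finite_nat_set_iff_bounded)
  \<comment> \<open>The 3 keeps the argument and result names 0, 1, 2 apart from the program's own
    data, whether or not \<open>P\<close> writes them.\<close>
  define b where "b = c + 3"
  \<comment> \<open>The exponent \<open>2 * k + 4\<close>: calls need
    \<open>(3 * m + 1) ^ k \<le> 2 ^ w\<close>, and \<open>3 * m + 1 \<le> (n + 1)\<^sup>2\<close>;
    the 4 provides \<open>4 * (n + 1)\<^sup>2 \<le> (n + 1) ^ 4\<close>, which holds for
    \<open>n \<ge> 1\<close>.\<close>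
  have solve: "halts_within w (ram_mult.nwt_prog b P) s (1300 * MM n n n)
      (\<lambda>s'. var s' 0 = of_bool (zero_triangle E wt))"
    if n: "1 \<le> n" and long: "long_words (2 * k + 4) n w" and graph: "simple_graph {..<n} E"
      and s: "word_state w s" "var s 0 = int n"
        "stores_mat s 0 (mat n n (\<lambda>(u, v). of_bool ({u, v} \<in> E)))" "\<forall>v<n. warr s 0 (int v) = wt v"
    for w n E wt s
  proof -
    define f where "f = MM n n n / (real n)\<^sup>2"
    have mono: "MM m m m / (real m)\<^sup>2 \<le> f" if "1 \<le> m" "m \<le> n" for m
      using monotone_onD[OF assms(2), of m n] that n by (simp add: f_def)
    have N: "(n + 1) ^ (2 * k + 4) \<le> 2 ^ w" using long by (simp add: long_words_def)
    have "4 * (n + 1)\<^sup>2 \<le> (n + 1)\<^sup>2 * (n + 1)\<^sup>2"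
      using n power_mono[of 2 "n + 1" 2] by (intro mult_right_mono) auto
    also have "\<dots> = (n + 1) ^ 4" by (simp flip: power_add)
    also have "\<dots> \<le> (n + 1) ^ (2 * k + 4)" by (intro power_increasing) auto
    finally have wide: "4 * (n + 1)\<^sup>2 \<le> 2 ^ w" using N by linarith
    have long_m: "long_words k (m + m + m) w" if "m \<le> n" for m
    proof -
      have "n \<le> n * n" using n by simp
      moreover have "(n + 1)\<^sup>2 = n * n + n + n + 1" by (simp add: power2_eq_square)
      ultimately have "m + m + m + 1 \<le> (n + 1)\<^sup>2" using that by linarith
      then have "(m + m + m + 1) ^ k \<le> ((n + 1)\<^sup>2) ^ k" by (intro power_mono) auto
      also have "\<dots> = (n + 1) ^ (2 * k)" by (simp add: power_mult)
      also have "\<dots> \<le> (n + 1) ^ (2 * k + 4)" by (intro power_increasing) auto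
      finally show ?thesis using N by (simp add: long_words_def)
    qed
    interpret ram_mult w n b P f
    proof
      show "3 \<le> b" by (simp add: b_def)
      show "1 \<le> n" by (rule n)
      show "4 * (n + 1)\<^sup>2 \<le> 2 ^ w" by (rule wide)
      show "x < b" if "x \<in> wr_var P \<union> wr_arr P \<union> wr_warr P" for x
        using bspec[OF c that] by (simp add: b_def)
      show "1 \<le> f" using mono[of 1] n matmul_time_ge_1[OF assms(1)] by simp
      show "halts_within w P s (f * (real m)\<^sup>2) (\<lambda>s'. \<forall>i<m. \<forall>j<m.
          (arr s' 2 (int i * int m + int j) \<noteq> 0) = (\<exists>l<m. \<alpha> i l \<and> \<beta> l j))"
        if m: "1 \<le> m" "m \<le> n" and s: "word_state w s" "var s 0 = int m" "var s 1 = int m" "var s 2 = int m"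
          "\<forall>i<m. \<forall>j<m. arr s 0 (int i * int m + int j) = of_bool (\<alpha> i j)"
          "\<forall>i<m. \<forall>j<m. arr s 1 (int i * int m + int j) = of_bool (\<beta> i j)" for m s \<alpha> \<beta>
      proof -
        let ?A = "mat m m (\<lambda>(i, j). of_bool (\<alpha> i j)) :: int mat"
        let ?B = "mat m m (\<lambda>(i, j). of_bool (\<beta> i j)) :: int mat"
        \<comment> \<open>Entries 0 and 1 respect the bound for every \<open>d\<close>, including
          0.\<close>
        have "bounded_mat (int (m + m + m) ^ d) (mat m m (\<lambda>(i, j). of_bool (g i j)))" for g
        proof -
          have "1 \<le> int (m + m + m) ^ d" using m by (intro one_le_power) auto
          moreover have "\<bar>of_bool p :: int\<bar> \<le> 1" for p by simp
          ultimately show ?thesis unfolding bounded_mat_def by (auto intro: order.trans)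
        qed
        then have "halts_within w P s (MM m m m) (\<lambda>s'. stores_mat s' 2 (?A * ?B))"
          using m s long_m[OF m(2)] by (intro P[rule_format]) (auto simp: stores_mat_def)
        then show ?thesis
        proof (rule halts_within_mono)
          show "MM m m m \<le> f * (real m)\<^sup>2" using mono[OF m] m by (simp add: field_simps)
          fix s' assume st: "stores_mat s' 2 (?A * ?B)"
          have "arr s' 2 (int i * int m + int j) \<noteq> 0 \<longleftrightarrow> (\<exists>l<m. \<alpha> i l \<and> \<beta> l j)" if "i < m" "j < m" for i j
          proof -
            \<comment> \<open>The integer product counts witnesses \<open>l\<close>; its summands
              are nonnegative, so nothing cancels and nonzero means that a witness exists.\<close>
            have "arr s' 2 (int i * int m + int j) = (\<Sum>l = 0..<m. of_bool (\<alpha> i l) * of_bool (\<beta> l j))"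
              using st that by (simp add: stores_mat_def scalar_prod_def)
            also have "\<dots> = (\<Sum>l = 0..<m. of_bool (\<alpha> i l \<and> \<beta> l j))" by (simp only: of_bool_conj)
            finally show ?thesis
              by (simp add: sum_nonneg_eq_0_iff) (auto simp: atLeast0LessThan)
          qed
          then show "\<forall>i<m. \<forall>j<m. (arr s' 2 (int i * int m + int j) \<noteq> 0) = (\<exists>l<m. \<alpha> i l \<and> \<beta> l j)"
            by blast
        qed
      qed
    qed
    have "1300 * f * (real n)\<^sup>2 = 1300 * MM n n n" using n by (simp add: f_def)
    with nwt_prog[OF s graph] show ?thesis by (simp only:)
  qed
  show "nwt_solvable_in_time (\<lambda>n. 1300 * MM n n n)"
    unfolding nwt_solvable_in_time_def using solve by blast
qed

end
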